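(* There are strictly positive constants $C(\underline\omega)$ (sufficiently large) and $c(\underline\omega)$, depending only on the eigenfrequencies $\underline\omega=(\omega_1,\dots,\omega_N)$, with the following property. Suppose that the motion from the level set $\rho=M$ to the level set $\rho=M'$ under the basic control $u(x)=-\mathrm{sign}\langle B,\frac{\partial\rho}{\partial x}(x)\rangle$ proceeds within the domain $\{\rho(x)\ge C(\underline\omega)\}$, in a time interval of integer length $T$. Then $T\le c(\underline\omega)\,(M-M')$.
   Context: Let $\omega_1,\dots,\omega_N>0$ be pairwise distinct (resonances are allowed). The state is $x=(x_1,y_1,\dots,x_N,y_N)^*\in\mathbb{R}^{2N}$, and $\dot x=Ax+Bu$ means $\dot x_i=y_i$, $\dot y_i=-\omega_i^2x_i+u$, $i=1,\dots,N$; so $A$ is block diagonal with blocks $\begin{pmatrix}0&1\\-\omega_i^2&0\end{pmatrix}$ and $B=(0,1,\dots,0,1)^*$. For $p=(\xi_1,\eta_1,\dots,\xi_N,\eta_N)\in\mathbb{R}^{2N}$ put $z_i=(\eta_i^2+\omega_i^{-2}\xi_i^2)^{1/2}$ and $$H(p)=\frac1{(2\pi)^N}\int_{(\mathbb{R}/2\pi\mathbb{Z})^N}\Big|\sum_{i=1}^N z_i\cos\varphi_i\Big|\,d\varphi_1\cdots d\varphi_N .$$ $H$ is a norm; $\rho(x)=\max_{H(p)\le1}\langle x,p\rangle$ is the dual norm, differentiable outside $0$. $\mathrm{sign}$ is the multivalued function $\mathrm{sign}(s)=\pm1$ for $s\gtrless0$, $\mathrm{sign}(0)=[-1,1]$;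 a motion under the basic control is an absolutely continuous solution of the differential inclusion $\dot x\in Ax+Bu(x)$. *)

theory Defs
  imports "HOL-Analysis.Analysis"
begin

text \<open>
  The phase space of N oscillators is the Euclidean space \<open>(real \<times> real) ^ 'n\<close> with
  \<open>N = CARD('n)\<close>; the pair \<open>x $ i\<close> is \<open>(x\<^sub>i, y\<^sub>i)\<close>, and a dual vector has
  \<open>p $ i = (\<xi>\<^sub>i, \<eta>\<^sub>i)\<close>. Its inner product is the standard one of dimension \<open>2 N\<close>.
\<close>

type_synonym 'n phase = "(real \<times> real) ^ 'n"

definition drift :: "('n \<Rightarrow> real) \<Rightarrow> 'n::finite phase \<Rightarrow> 'n phase" where
  "drift \<omega> x = (\<chi> i. (snd (x $ i), - (\<omega> i)\<^sup>2 * fst (x $ i)))"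

definition Bvec :: "'n::finite phase" where
  "Bvec = (\<chi> i. (0, 1))"

definition amplitude :: "('n \<Rightarrow> real) \<Rightarrow> 'n::finite phase \<Rightarrow> 'n \<Rightarrow> real" where
  "amplitude \<omega> p i = sqrt ((snd (p $ i))\<^sup>2 + (fst (p $ i))\<^sup>2 / (\<omega> i)\<^sup>2)"

text \<open>The torus average is taken over the fundamental domain \<open>[0, 2\<pi>]\<^sup>N\<close>.\<close>

definition Hnorm :: "('n \<Rightarrow> real) \<Rightarrow> 'n::finite phase \<Rightarrow> real" where
  "Hnorm \<omega> p = 1 / (2 * pi) ^ CARD('n) *
     (LINT \<phi> : cbox (0 :: real ^ 'n) (\<chi> i. 2 * pi) | lborel.
        \<bar>\<Sum>i\<in>UNIV. amplitude \<omega> p i * cos (\<phi> $ i)\<bar>)"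

definition rho :: "('n \<Rightarrow> real) \<Rightarrow> 'n::finite phase \<Rightarrow> real" where
  "rho \<omega> x = (SUP p \<in> {p. Hnorm \<omega> p \<le> 1}. x \<bullet> p)"

text \<open>Meaningful only where \<open>f\<close> is differentiable; for \<open>rho\<close> this excludes just the origin.\<close>

definition gradient :: "('a::real_inner \<Rightarrow> real) \<Rightarrow> 'a \<Rightarrow> 'a" where
  "gradient f x = (THE D. GDERIV f x :> D)"

definition multisign :: "real \<Rightarrow> real set" where
  "multisign s = (if s = 0 then {-1..1} else {sgn s})"

definition basic_control :: "('n \<Rightarrow> real) \<Rightarrow> 'n::finite phase \<Rightarrow> real set" where
  "basic_control \<omega> x = uminus ` multisign (Bvec \<bullet> gradient (rho \<omega>) x)"

text \<open>
  The usual \<open>\<epsilon>\<close>-\<open>\<delta>\<close> notion: a division of its own union is a finite family of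
  non-overlapping compact intervals.
\<close>

definition abs_continuous_on_interval ::
    "real \<Rightarrow> real \<Rightarrow> (real \<Rightarrow> 'a::real_normed_vector) \<Rightarrow> bool" where
  "abs_continuous_on_interval a b f \<longleftrightarrow>
     (\<forall>\<epsilon>>0. \<exists>\<delta>>0. \<forall>\<D>. \<D> division_of \<Union>\<D> \<and> \<Union>\<D> \<subseteq> {a..b} \<and>
        (\<Sum>K\<in>\<D>. Sup K - Inf K) < \<delta> \<longrightarrow> (\<Sum>K\<in>\<D>. norm (f (Sup K) - f (Inf K))) < \<epsilon>)"

definition basic_motion ::
    "('n \<Rightarrow> real) \<Rightarrow> real \<Rightarrow> real \<Rightarrow> (real \<Rightarrow> 'n::finite phase) \<Rightarrow> bool" where
  "basic_motion \<omega> a b x \<longleftrightarrow>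
     abs_continuous_on_interval a b x \<and>
     (AE t in lborel. t \<in> {a..b} \<longrightarrow>
        (\<exists>u \<in> basic_control \<omega> (x t).
           (x has_vector_derivative (drift \<omega> (x t) + u *\<^sub>R Bvec)) (at t within {a..b})))"

end

theory Submission
  imports Defs
begin

text \<open>
  Along a motion \<open>x\<close> under the basic control the free dynamics preserves \<open>\<rho>\<close>, because its
  transpose rotates each pair \<open>(\<xi>\<^sub>i/\<omega>\<^sub>i, \<eta>\<^sub>i)\<close> and so preserves the amplitudes \<open>z\<^sub>i\<close>. Hence
  \<open>d\<rho>/dt = - \<bar>\<langle>B, \<partial>\<rho>/\<partial>x\<rangle>\<bar>\<close> for almost every time, and it suffices to show that \<open>\<rho>\<close> loses a
  fixed amount \<open>\<delta>\<close> in each unit of time spent far from the origin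
  (\<open>unit_time_decrease\<close>); then \<open>c = 1/\<delta>\<close> works.

  Work with the pulled-back motion \<open>y(t) = e\<^sup>(\<^sup>a\<^sup>-\<^sup>t\<^sup>)\<^sup>A x(t)\<close>, whose velocity is the control times
  \<open>e\<^sup>(\<^sup>a\<^sup>-\<^sup>t\<^sup>)\<^sup>A B\<close>. It moves by a bounded amount in unit time, whereas \<open>\<partial>\<rho>/\<partial>x\<close> is continuous and
  homogeneous of degree zero; so far from the origin \<open>\<partial>\<rho>/\<partial>x (y(t))\<close> is nearly a constant vector
  \<open>p\<close> with \<open>H(p) = 1\<close> (\<open>support_slowly_varying\<close>). The loss is therefore close to the integral
  of \<open>\<bar>\<langle>e\<^sup>-\<^sup>s\<^sup>A B, p\<rangle>\<bar>\<close> over \<open>0 \<le> s \<le> 1\<close>. This integral is itself a norm of \<open>p\<close>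
  (\<open>norm_functional_observation\<close>): it vanishes only at \<open>p = 0\<close> since harmonics of distinct
  frequencies are linearly independent. By compactness it is bounded below on \<open>H(p) = 1\<close>.

  Two facts support this. First, \<open>\<rho>\<close> is differentiable outside the origin, with gradient the
  unique maximiser of \<open>\<langle>x, p\<rangle>\<close> over \<open>H(p) \<le> 1\<close>; this is dual to the strict convexity of \<open>H\<close>
  (\<open>strictly_convex_norm_Hnorm\<close>), which holds because two trigonometric sums
  \<open>\<Sum>\<^sub>i a\<^sub>i cos \<phi>\<^sub>i + b\<^sub>i sin \<phi>\<^sub>i\<close> of equal sign everywhere on the torus are proportional. Second, an
  absolutely continuous function is the integral of its almost everywhere derivative
  (\<open>fundamental_theorem_of_calculus_abs_continuous\<close>).
\<close>

section \<open>Absolutely continuous functions\<close>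

lemma abs_continuous_on_intervalD:
  assumes "abs_continuous_on_interval a b f" "\<epsilon> > 0"
  obtains \<delta> where "\<delta> > 0"
    "\<And>\<D>. \<D> division_of \<Union>\<D> \<Longrightarrow> \<Union>\<D> \<subseteq> {a..b} \<Longrightarrow> (\<Sum>K\<in>\<D>. Sup K - Inf K) < \<delta>
       \<Longrightarrow> (\<Sum>K\<in>\<D>. norm (f (Sup K) - f (Inf K))) < \<epsilon>"
proof -
  from mp[OF spec[OF assms(1)[unfolded abs_continuous_on_interval_def]] assms(2)]
  obtain \<delta> where "\<delta> > 0" and
    "\<forall>\<D>. \<D> division_of \<Union>\<D> \<and> \<Union>\<D> \<subseteq> {a..b} \<and> (\<Sum>K\<in>\<D>. Sup K - Inf K) < \<delta>
       \<longrightarrow> (\<Sum>K\<in>\<D>. norm (f (Sup K) - f (Inf K))) < \<epsilon>"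
    by (elim exE conjE)
  then show thesis
    by (intro that[of \<delta>]) simp_all
qed

lemma abs_continuous_on_interval_subset:
  assumes "abs_continuous_on_interval a b f" "{c..d} \<subseteq> {a..b}"
  shows "abs_continuous_on_interval c d f"
  unfolding abs_continuous_on_interval_def
proof (intro allI impI)
  fix \<epsilon> :: real assume "\<epsilon> > 0"
  then obtain \<delta> where "\<delta> > 0" "\<And>\<D>. \<D> division_of \<Union>\<D> \<Longrightarrow> \<Union>\<D> \<subseteq> {a..b} \<Longrightarrow>
      (\<Sum>K\<in>\<D>. Sup K - Inf K) < \<delta> \<Longrightarrow> (\<Sum>K\<in>\<D>. norm (f (Sup K) - f (Inf K))) < \<epsilon>"
    using abs_continuous_on_intervalD[OF assms(1)] by blast
  then show "\<exists>\<delta>>0. \<forall>\<D>. \<D> division_of \<Union>\<D> \<and> \<Union>\<D> \<subseteq> {c..d} \<and> (\<Sum>K\<in>\<D>. Sup K - Inf K) < \<delta>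
      \<longrightarrow> (\<Sum>K\<in>\<D>. norm (f (Sup K) - f (Inf K))) < \<epsilon>"
    using subset_trans[OF _ assms(2)] by (intro exI[of _ \<delta>]) blast
qed

lemma division_of_real_memberE:
  fixes K :: "real set"
  assumes "\<D> division_of S" "K \<in> \<D>"
  obtains u v where "K = {u..v}" "u \<le> v" "Inf K = u" "Sup K = v"
proof -
  obtain u v where "K = {u..v}" "K \<noteq> {}"
    using division_ofD(3,4)[OF assms] by (auto simp: box_real)
  then show ?thesis using that[of u v] by auto
qed

text \<open>
  Absolute continuity passes to every function whose increments are dominated by those of an
  absolutely continuous function and of the identity. This one criterion covers the restriction
  of a Lipschitz function to the motion and the product of the motion with a smooth matrix.
\<close>

lemma abs_continuous_on_interval_comparison:
  assumes ac: "abs_continuous_on_interval a b f" and "A \<ge> 0" "B \<ge> 0"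
    and le: "\<And>u v. a \<le> u \<Longrightarrow> u \<le> v \<Longrightarrow> v \<le> b \<Longrightarrow>
               norm (g v - g u) \<le> A * norm (f v - f u) + B * (v - u)"
  shows "abs_continuous_on_interval a b g"
  unfolding abs_continuous_on_interval_def
proof (intro allI impI)
  fix \<epsilon> :: real assume "\<epsilon> > 0"
  define \<eta> where "\<eta> = \<epsilon> / (2 * (A + 1))"
  have "\<eta> > 0" and A\<eta>: "A * \<eta> < \<epsilon> / 2"
    using \<open>\<epsilon> > 0\<close> \<open>A \<ge> 0\<close> by (auto simp: \<eta>_def field_simps)
  obtain \<delta> where "\<delta> > 0" and \<delta>: "\<And>\<D>. \<D> division_of \<Union>\<D> \<Longrightarrow> \<Union>\<D> \<subseteq> {a..b} \<Longrightarrow>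
      (\<Sum>K\<in>\<D>. Sup K - Inf K) < \<delta> \<Longrightarrow> (\<Sum>K\<in>\<D>. norm (f (Sup K) - f (Inf K))) < \<eta>"
    using abs_continuous_on_intervalD[OF ac \<open>\<eta> > 0\<close>] by blast
  define \<delta>' where "\<delta>' = min \<delta> (\<epsilon> / (2 * (B + 1)))"
  show "\<exists>\<delta>>0. \<forall>\<D>. \<D> division_of \<Union>\<D> \<and> \<Union>\<D> \<subseteq> {a..b} \<and> (\<Sum>K\<in>\<D>. Sup K - Inf K) < \<delta>
          \<longrightarrow> (\<Sum>K\<in>\<D>. norm (g (Sup K) - g (Inf K))) < \<epsilon>"
  proof (intro exI[of _ \<delta>'] conjI allI impI)
    show "\<delta>' > 0"
      using \<open>\<delta> > 0\<close> \<open>\<epsilon> > 0\<close> \<open>B \<ge> 0\<close> by (simp add: \<delta>'_def)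
    fix \<D> :: "real set set"
    assume D: "\<D> division_of \<Union>\<D> \<and> \<Union>\<D> \<subseteq> {a..b} \<and> (\<Sum>K\<in>\<D>. Sup K - Inf K) < \<delta>'"
    have "norm (g (Sup K) - g (Inf K)) \<le> A * norm (f (Sup K) - f (Inf K)) + B * (Sup K - Inf K)"
      if K: "K \<in> \<D>" for K
    proof -
      obtain u v where uv: "K = {u..v}" "u \<le> v" "Inf K = u" "Sup K = v"
        by (rule division_of_real_memberE[OF conjunct1[OF D] K])
      moreover have "K \<subseteq> {a..b}" using D that by blast
      ultimately show ?thesis by (auto intro!: le)
    qed
    then have "(\<Sum>K\<in>\<D>. norm (g (Sup K) - g (Inf K)))
        \<le> (\<Sum>K\<in>\<D>. A * norm (f (Sup K) - f (Inf K)) + B * (Sup K - Inf K))"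
      by (rule sum_mono)
    also have "\<dots> = A * (\<Sum>K\<in>\<D>. norm (f (Sup K) - f (Inf K))) + B * (\<Sum>K\<in>\<D>. Sup K - Inf K)"
      by (simp only: sum.distrib sum_distrib_left)
    also have "\<dots> \<le> A * \<eta> + B * (\<epsilon> / (2 * (B + 1)))"
    proof (intro add_mono mult_left_mono)
      show "(\<Sum>K\<in>\<D>. norm (f (Sup K) - f (Inf K))) \<le> \<eta>"
        using \<delta>[of \<D>] D by (auto simp: \<delta>'_def)
      show "(\<Sum>K\<in>\<D>. Sup K - Inf K) \<le> \<epsilon> / (2 * (B + 1))"
        using D by (auto simp: \<delta>'_def)
    qed (use assms in auto)
    also have "\<dots> < \<epsilon>"
    proof -
      have "B * (\<epsilon> / (2 * (B + 1))) \<le> \<epsilon> / 2"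
        using \<open>\<epsilon> > 0\<close> \<open>B \<ge> 0\<close> by (simp add: field_simps)
      then show ?thesis using A\<eta> by linarith
    qed
    finally show "(\<Sum>K\<in>\<D>. norm (g (Sup K) - g (Inf K))) < \<epsilon>" .
  qed
qed

lemma abs_continuous_on_interval_imp_continuous_on:
  assumes "abs_continuous_on_interval a b f"
  shows "continuous_on {a..b} f"
  unfolding continuous_on_iff
proof (intro ballI allI impI)
  fix s \<epsilon> :: real assume s: "s \<in> {a..b}" and "\<epsilon> > 0"
  obtain \<delta> where "\<delta> > 0" and \<delta>: "\<And>\<D>. \<D> division_of \<Union>\<D> \<Longrightarrow> \<Union>\<D> \<subseteq> {a..b} \<Longrightarrow>
      (\<Sum>K\<in>\<D>. Sup K - Inf K) < \<delta> \<Longrightarrow> (\<Sum>K\<in>\<D>. norm (f (Sup K) - f (Inf K))) < \<epsilon>"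
    using abs_continuous_on_intervalD[OF assms \<open>\<epsilon> > 0\<close>] by blast
  have *: "norm (f v - f u) < \<epsilon>" if "a \<le> u" "u \<le> v" "v \<le> b" "v - u < \<delta>" for u v
    using \<delta>[of "{{u..v}}"] that division_of_self[of u v] by auto
  show "\<exists>d>0. \<forall>t\<in>{a..b}. dist t s < d \<longrightarrow> dist (f t) (f s) < \<epsilon>"
  proof (intro exI[of _ \<delta>] conjI ballI impI)
    fix t assume "t \<in> {a..b}" "dist t s < \<delta>"
    then show "dist (f t) (f s) < \<epsilon>"
      using *[of s t] *[of t s] s
      by (cases "s \<le> t") (auto simp: dist_norm norm_minus_commute)
  qed (rule \<open>\<delta> > 0\<close>)
qed

text \<open>
  The fundamental theorem for absolutely continuous functions, in gauge form. Enclose the null set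
  of exceptional points in an open set \<open>U\<close> so small that the increments of \<open>f\<close> over any
  non-overlapping intervals inside \<open>U\<close> have a small sum, and let the gauge force every interval
  tagged at an exceptional point into \<open>U\<close>. The remaining intervals are handled by
  differentiability at their tags; no covering theorem is needed.
\<close>

theorem fundamental_theorem_of_calculus_abs_continuous:
  fixes f :: "real \<Rightarrow> 'a::banach"
  assumes "a \<le> b" and ac: "abs_continuous_on_interval a b f"
    and ae: "AE t in lborel. t \<in> {a..b} \<longrightarrow> (f has_vector_derivative f' t) (at t within {a..b})"
  shows "(f' has_integral (f b - f a)) {a..b}"
proof -
  define E where "E = {t\<in>{a..b}. \<not> (f has_vector_derivative f' t) (at t within {a..b})}"
  have E0: "E \<in> null_sets lebesgue"
  proof -
    have "AE t in lebesgue. t \<notin> E"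
      using AE_completion[OF ae] by (rule AE_mp) (simp add: E_def)
    then obtain N where "N \<in> null_sets lebesgue" "E \<subseteq> N"
      by (auto simp: eventually_ae_filter)
    then show ?thesis
      using null_sets_completion_subset by blast
  qed
  define h where "h t = (if t \<in> E then 0 else f' t)" for t
  have h: "(f has_vector_derivative h t) (at t within {a..b})" if "t \<in> {a..b}" "t \<notin> E" for t
    using that by (auto simp: h_def E_def)
  have "(h has_integral (f b - f a)) {a..b}"
    unfolding has_integral_real
  proof (intro allI impI)
    fix e :: real assume "e > 0"
    define \<epsilon> where "\<epsilon> = e / (2 * (b - a + 1))"
    have "\<epsilon> > 0" and \<epsilon>: "\<epsilon> * (b - a) \<le> e / 2"
      using \<open>e > 0\<close> \<open>a \<le> b\<close> by (auto simp: \<epsilon>_def field_simps)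
    obtain \<delta> where "\<delta> > 0" and \<delta>: "\<And>\<D>. \<D> division_of \<Union>\<D> \<Longrightarrow> \<Union>\<D> \<subseteq> {a..b} \<Longrightarrow>
        (\<Sum>K\<in>\<D>. Sup K - Inf K) < \<delta> \<Longrightarrow> (\<Sum>K\<in>\<D>. norm (f (Sup K) - f (Inf K))) < e / 2"
      using abs_continuous_on_intervalD[OF ac half_gt_zero[OF \<open>e > 0\<close>]] by blast
    obtain U where U: "open U" "E \<subseteq> U" "U - E \<in> lmeasurable" "emeasure lebesgue (U - E) < ennreal \<delta>"
      using sets_lebesgue_outer_open[OF _ \<open>\<delta> > 0\<close>, of E] E0 by auto
    have Um: "U \<in> lmeasurable" "measure lebesgue U < \<delta>"
    proof -
      have eq: "emeasure lebesgue U = emeasure lebesgue (U - E)"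
        using emeasure_Diff_null_set[OF E0, of U] \<open>open U\<close> by simp
      have "emeasure lebesgue U < ennreal \<delta>" using U(4) eq by simp
      then show "U \<in> lmeasurable"
        using \<open>open U\<close> by (intro fmeasurableI) (auto simp: top.not_eq_extremum intro: order.strict_trans)
      then show "measure lebesgue U < \<delta>"
        using \<open>emeasure lebesgue U < ennreal \<delta>\<close> \<open>\<delta> > 0\<close>
        by (simp add: emeasure_eq_measure2 ennreal_less_iff)
    qed
    have "\<exists>d>0. x \<in> {a..b} - E \<longrightarrow>
         (\<forall>y\<in>{a..b}. norm (y-x) < d \<longrightarrow> norm (f y - f x - (y-x) *\<^sub>R h x) \<le> \<epsilon> * norm (y-x))" for x
    proof (cases "x \<in> {a..b} - E")
      case True
      then show ?thesis
        using h[of x] \<open>\<epsilon> > 0\<close> unfolding has_vector_derivative_def has_derivative_within_alt by blast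
    next
      case False
      then show ?thesis by (intro exI[of _ 1]) auto
    qed
    then obtain d where "\<forall>x. d x > 0 \<and> (x \<in> {a..b} - E \<longrightarrow>
         (\<forall>y\<in>{a..b}. norm (y-x) < d x \<longrightarrow> norm (f y - f x - (y-x) *\<^sub>R h x) \<le> \<epsilon> * norm (y-x)))"
      using choice[where Q = "\<lambda>x d. d > 0 \<and> (x \<in> {a..b} - E \<longrightarrow>
         (\<forall>y\<in>{a..b}. norm (y-x) < d \<longrightarrow> norm (f y - f x - (y-x) *\<^sub>R h x) \<le> \<epsilon> * norm (y-x)))"]
      by blast
    then have d: "\<And>x. 0 < d x"
      "\<And>x y. \<lbrakk>x \<in> {a..b}; x \<notin> E; y \<in> {a..b}; norm (y-x) < d x\<rbrakk>
          \<Longrightarrow> norm (f y - f x - (y-x) *\<^sub>R h x) \<le> \<epsilon> * norm (y-x)"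
      by blast+
    define \<gamma> where "\<gamma> x = (if x \<in> E then U else ball x (d x))" for x
    have "gauge \<gamma>"
      using U d(1) by (auto simp: gauge_def \<gamma>_def)
    have est: "norm ((\<Sum>(x,K)\<in>\<D>. measure lborel K *\<^sub>R h x) - (f b - f a)) < e"
      if tag: "\<D> tagged_division_of {a..b}" and fine: "\<gamma> fine \<D>" for \<D>
    proof -
      have fin: "finite \<D>" using tag by auto
      have KD: "\<exists>u v. K = {u..v} \<and> u \<le> v \<and> x \<in> {u..v} \<and> a \<le> u \<and> v \<le> b" if "(x, K) \<in> \<D>" for x K
      proof -
        have "x \<in> K" "K \<subseteq> {a..b}" and "\<exists>u v. K = cbox u v"
          using tagged_division_ofD[OF tag] that by blast+
        then obtain u v where "K = {u..v}" by (auto simp: box_real)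
        then show ?thesis using \<open>x \<in> K\<close> \<open>K \<subseteq> {a..b}\<close> by (intro exI[of _ u] exI[of _ v]) auto
      qed
      \<comment> \<open>\<open>G\<close> collects the intervals with a good tag, \<open>F\<close> those with an exceptional one\<close>
      define G where "G = {(x, K) \<in> \<D>. x \<notin> E}"
      define F where "F = {(x, K) \<in> \<D>. x \<in> E}"
      have GF: "\<D> = G \<union> F" "G \<inter> F = {}" by (auto simp: G_def F_def)
      have finGF: "finite G" "finite F" using fin GF by auto
      let ?D = "\<lambda>K. f (Sup K) - f (Inf K)"
      have "(\<Sum>(x,K)\<in>\<D>. measure lborel K *\<^sub>R h x) - (f b - f a) = (\<Sum>(x,K)\<in>\<D>. measure lborel K *\<^sub>R h x - ?D K)"
        using additive_tagged_division_1[OF \<open>a \<le> b\<close> tag, of f]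
        by (simp add: sum_subtractf case_prod_beta)
      also have "\<dots> = (\<Sum>(x,K)\<in>G. measure lborel K *\<^sub>R h x - ?D K) + (\<Sum>(x,K)\<in>F. measure lborel K *\<^sub>R h x - ?D K)"
        unfolding GF(1) by (rule sum.union_disjoint) (use finGF GF in auto)
      finally have eq: "(\<Sum>(x,K)\<in>\<D>. measure lborel K *\<^sub>R h x) - (f b - f a) = \<dots>" .
      have "norm (\<Sum>(x,K)\<in>G. measure lborel K *\<^sub>R h x - ?D K) \<le> (\<Sum>(x,K)\<in>G. \<epsilon> * (Sup K - Inf K))"
      proof (rule sum_norm_le, clarify)
        fix x K assume "(x, K) \<in> G"
        then have xK: "(x, K) \<in> \<D>" "x \<notin> E" by (auto simp: G_def)
        obtain u v where uv: "K = {u..v}" "u \<le> v" "x \<in> {u..v}" "a \<le> u" "v \<le> b"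
          using KD[OF xK(1)] by blast
        have "K \<subseteq> ball x (d x)"
          using fineD[OF fine xK(1)] xK(2) by (simp add: \<gamma>_def)
        then have uvd: "norm (u - x) < d x" "norm (v - x) < d x"
          using uv subsetD[of K "ball x (d x)" u] subsetD[of K "ball x (d x)" v]
          by (simp_all add: dist_norm norm_minus_commute del: real_norm_def)
        have "norm ((v - u) *\<^sub>R h x - (f v - f u))
            = norm ((f u - f x - (u - x) *\<^sub>R h x) - (f v - f x - (v - x) *\<^sub>R h x))"
          by (simp add: algebra_simps)
        also have "\<dots> \<le> \<epsilon> * norm (u - x) + \<epsilon> * norm (v - x)"
        proof (rule order.trans[OF norm_triangle_ineq4 add_mono])
          show "norm (f u - f x - (u - x) *\<^sub>R h x) \<le> \<epsilon> * norm (u - x)"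
            using uvd uv xK(2) by (intro d(2)) auto
          show "norm (f v - f x - (v - x) *\<^sub>R h x) \<le> \<epsilon> * norm (v - x)"
            using uvd uv xK(2) by (intro d(2)) auto
        qed
        also have "\<dots> = \<epsilon> * (v - u)"
          using uv by (simp add: algebra_simps)
        finally show "norm (measure lborel K *\<^sub>R h x - (f (Sup K) - f (Inf K))) \<le> \<epsilon> * (Sup K - Inf K)"
          using uv by simp
      qed
      also have "\<dots> \<le> (\<Sum>(x,K)\<in>\<D>. \<epsilon> * (Sup K - Inf K))"
      proof (rule sum_mono2[OF fin])
        fix z assume "z \<in> \<D> - G"
        then show "0 \<le> (case z of (x, K) \<Rightarrow> \<epsilon> * (Sup K - Inf K))"
          using KD[of "fst z" "snd z"] \<open>\<epsilon> > 0\<close> by (auto simp: case_prod_beta)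
      qed (use GF in auto)
      also have "\<dots> = \<epsilon> * (b - a)"
        using additive_tagged_division_1[OF \<open>a \<le> b\<close> tag, of "\<lambda>x. x"]
        by (simp add: case_prod_beta flip: sum_distrib_left)
      finally have G: "norm (\<Sum>(x,K)\<in>G. measure lborel K *\<^sub>R h x - ?D K) \<le> e / 2"
        using \<epsilon> by simp
      have "norm (\<Sum>(x,K)\<in>F. measure lborel K *\<^sub>R h x - ?D K) \<le> (\<Sum>(x,K)\<in>F. norm (?D K))"
        by (rule sum_norm_le) (auto simp: F_def h_def norm_minus_commute)
      also have "\<dots> < e / 2"
      proof -
        have tagF: "F tagged_division_of \<Union>(snd ` F)"
          using tagged_partial_division_subset[of \<D> "{a..b}" F] tag
          by (intro tagged_partial_division_of_Union_self) (auto simp: F_def tagged_division_of_def)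
        have div: "snd ` F division_of \<Union>(snd ` F)"
          by (rule division_of_tagged_division[OF tagF])
        \<comment> \<open>the sum over tagged pairs becomes a sum over intervals; \<open>?N\<close> avoids the arbitrary
          value of \<open>Sup\<close> and \<open>Inf\<close> at the empty set\<close>
        let ?N = "\<lambda>K. if K = {} then 0 else norm (?D K)"
        have "(\<Sum>(x,K)\<in>F. norm (?D K)) = (\<Sum>(x,K)\<in>F. ?N K)"
          using KD by (intro sum.cong) (fastforce simp: F_def)+
        also have "\<dots> = sum ?N (snd ` F)"
          by (rule sum.over_tagged_division_lemma[OF tagF]) (auto simp: box_real)
        also have "\<dots> = (\<Sum>K\<in>snd ` F. norm (?D K))"
          using division_ofD(3)[OF div] by (intro sum.cong) auto
        also have "\<dots> < e / 2"
        proof (rule \<delta>[OF div])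
          show "\<Union>(snd ` F) \<subseteq> {a..b}"
            using KD by (fastforce simp: F_def)
          have "(\<Sum>K\<in>snd ` F. Sup K - Inf K) = (\<Sum>K\<in>snd ` F. measure lborel K)"
            by (intro sum.cong refl, erule division_of_real_memberE[OF div]) simp
          also have "\<dots> = measure lebesgue (\<Union>(snd ` F))"
          proof -
            have "(\<Sum>K\<in>snd ` F. measure lborel K) = (\<Sum>K\<in>snd ` F. measure lebesgue K)"
              using division_ofD(4)[OF div] by (intro sum.cong refl) (metis borel_closed closed_cbox measure_completion sets_lborel)
            then show ?thesis using content_division[OF div] by simp
          qed
          also have "\<dots> \<le> measure lebesgue U"
          proof (rule measure_mono_fmeasurable)
            have "K \<subseteq> U" if "(x, K) \<in> F" for x K
              using that fineD[OF fine, of x K] by (auto simp: F_def \<gamma>_def)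
            then show "\<Union>(snd ` F) \<subseteq> U" by fastforce
            show "\<Union>(snd ` F) \<in> sets lebesgue"
              using lmeasurable_division[OF div] by auto
          qed (rule Um)
          also have "\<dots> < \<delta>" by (rule Um)
          finally show "(\<Sum>K\<in>snd ` F. Sup K - Inf K) < \<delta>" .
        qed
        finally show ?thesis .
      qed
      finally show ?thesis
        unfolding eq using G by (intro norm_triangle_lt) linarith
    qed
    show "\<exists>\<gamma>. gauge \<gamma> \<and> (\<forall>\<D>. \<D> tagged_division_of {a..b} \<and> \<gamma> fine \<D> \<longrightarrow>
        norm ((\<Sum>(x,K)\<in>\<D>. measure lborel K *\<^sub>R h x) - (f b - f a)) < e)"
    proof (intro exI[of _ \<gamma>] conjI allI impI)
      show "gauge \<gamma>" by fact
    qed (elim conjE, rule est)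
  qed
  moreover have "negligible E"
    using E0 by (simp add: negligible_iff_null_sets)
  ultimately show ?thesis
    using has_integral_spike_eq[of E "{a..b}" h f' "f b - f a"] by (simp add: h_def)
qed

section \<open>Translation invariance of integrals over a torus\<close>

lemma cbox_Int_axis_le:
  fixes u w :: "real ^ 'n"
  shows "cbox u w \<inter> {x. x \<bullet> axis i 1 \<le> c} = cbox u (\<chi> j. if j = i then min (w $ j) c else w $ j)"
  by (auto simp: mem_box_cart inner_axis) (metis min.bounded_iff)+

lemma cbox_Int_axis_ge:
  fixes u w :: "real ^ 'n"
  shows "cbox u w \<inter> {x. x \<bullet> axis i 1 \<ge> c} = cbox (\<chi> j. if j = i then max (u $ j) c else u $ j) w"
  by (auto simp: mem_box_cart inner_axis) (metis max.bounded_iff)+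

text \<open>
  The translated box is cut at the hyperplane where coordinate \<open>i\<close> equals \<open>c\<close>, and the part
  beyond it is moved back by one period.
\<close>

lemma integral_torus_shift_coordinate:
  fixes f :: "real ^ 'n \<Rightarrow> real"
  assumes cont: "continuous_on UNIV f"
    and per: "\<And>\<phi>. f (\<phi> + c *\<^sub>R axis i 1) = f \<phi>"
    and \<theta>: "0 \<le> \<theta>" "\<theta> \<le> c"
  shows "integral (cbox 0 (\<chi> i. c)) (\<lambda>\<phi>. f (\<phi> + \<theta> *\<^sub>R axis i 1)) = integral (cbox 0 (\<chi> i. c)) f"
proof -
  let ?e = "axis i 1 :: real ^ 'n" and ?v = "(\<chi> i. c) :: real ^ 'n"
  have int: "f integrable_on cbox u w" for u w
    by (rule integrable_continuous) (rule continuous_on_subset[OF cont], simp)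
  have e: "?e \<in> Basis" by (simp add: axis_in_Basis_iff)
  have shift: "integral (cbox u w) (\<lambda>\<phi>. f (\<phi> + s *\<^sub>R ?e)) = integral (cbox (u + s *\<^sub>R ?e) (w + s *\<^sub>R ?e)) f"
    for u w s
    using integral_shift_cbox_plus[of u w f "s *\<^sub>R ?e"] by (simp add: o_def add.commute)
  have "integral (cbox 0 ?v) (\<lambda>\<phi>. f (\<phi> + \<theta> *\<^sub>R ?e)) = integral (cbox (\<theta> *\<^sub>R ?e) (?v + \<theta> *\<^sub>R ?e)) f"
    using shift[of 0 ?v \<theta>] by simp
  also have "\<dots> = integral (cbox (\<theta> *\<^sub>R ?e) (?v + \<theta> *\<^sub>R ?e) \<inter> {x. x \<bullet> ?e \<le> c}) f
                + integral (cbox (\<theta> *\<^sub>R ?e) (?v + \<theta> *\<^sub>R ?e) \<inter> {x. x \<bullet> ?e \<ge> c}) f"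
    by (rule integral_split[OF int e])
  also have "cbox (\<theta> *\<^sub>R ?e) (?v + \<theta> *\<^sub>R ?e) \<inter> {x. x \<bullet> ?e \<le> c} = cbox (\<theta> *\<^sub>R ?e) ?v"
    using \<theta> by (simp add: cbox_Int_axis_le cbox_Int_axis_ge)
      (rule arg_cong2[of _ _ _ _ cbox]; auto simp: vec_eq_iff axis_def)
  also have "cbox (\<theta> *\<^sub>R ?e) (?v + \<theta> *\<^sub>R ?e) \<inter> {x. x \<bullet> ?e \<ge> c}
           = cbox (0 + c *\<^sub>R ?e) ((?v + (\<theta> - c) *\<^sub>R ?e) + c *\<^sub>R ?e)"
    using \<theta> by (simp add: cbox_Int_axis_le cbox_Int_axis_ge)
      (rule arg_cong2[of _ _ _ _ cbox]; auto simp: vec_eq_iff axis_def)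
  also have "integral \<dots> f = integral (cbox 0 (?v + (\<theta> - c) *\<^sub>R ?e)) f"
    using shift[of 0 "?v + (\<theta> - c) *\<^sub>R ?e" c] by (simp only: per)
  also have "cbox 0 (?v + (\<theta> - c) *\<^sub>R ?e) = cbox 0 ?v \<inter> {x. x \<bullet> ?e \<le> \<theta>}"
    using \<theta> by (simp add: cbox_Int_axis_le cbox_Int_axis_ge)
      (rule arg_cong2[of _ _ _ _ cbox]; auto simp: vec_eq_iff axis_def)
  also have "cbox (\<theta> *\<^sub>R ?e) ?v = cbox 0 ?v \<inter> {x. x \<bullet> ?e \<ge> \<theta>}"
    using \<theta> by (simp add: cbox_Int_axis_le cbox_Int_axis_ge)
      (rule arg_cong2[of _ _ _ _ cbox]; auto simp: vec_eq_iff axis_def)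
  also have "integral (cbox 0 ?v \<inter> {x. x \<bullet> ?e \<ge> \<theta>}) f + integral (cbox 0 ?v \<inter> {x. x \<bullet> ?e \<le> \<theta>}) f
           = integral (cbox 0 ?v) f"
    using integral_split[OF int e, of 0 ?v \<theta>] by simp
  finally show ?thesis .
qed

lemma integral_torus_shift:
  fixes f :: "real ^ 'n \<Rightarrow> real"
  assumes cont: "continuous_on UNIV f"
    and per: "\<And>\<phi> i. f (\<phi> + c *\<^sub>R axis i 1) = f \<phi>"
    and \<theta>: "\<And>i. 0 \<le> \<theta> $ i \<and> \<theta> $ i \<le> c"
  shows "integral (cbox 0 (\<chi> i. c)) (\<lambda>\<phi>. f (\<phi> + \<theta>)) = integral (cbox 0 (\<chi> i. c)) f"
proof -
  have "integral (cbox 0 (\<chi> i. c)) (\<lambda>\<phi>. f (\<phi> + (\<Sum>i\<in>S. \<theta> $ i *\<^sub>R axis i 1)))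
      = integral (cbox 0 (\<chi> i. c)) f" if "finite S" for S
    using that
  proof (induction S)
    case (insert j S)
    let ?g = "\<lambda>\<phi>. f (\<phi> + (\<Sum>i\<in>S. \<theta> $ i *\<^sub>R axis i 1))"
    have "integral (cbox 0 (\<chi> i. c)) (\<lambda>\<phi>. ?g (\<phi> + \<theta> $ j *\<^sub>R axis j 1)) = integral (cbox 0 (\<chi> i. c)) ?g"
    proof (rule integral_torus_shift_coordinate)
      show "continuous_on UNIV ?g"
        by (rule continuous_on_compose2[OF cont]) (auto intro!: continuous_intros)
      show "?g (\<phi> + c *\<^sub>R axis j 1) = ?g \<phi>" for \<phi>
        using per[of "\<phi> + (\<Sum>i\<in>S. \<theta> $ i *\<^sub>R axis i 1)" j] by (simp add: algebra_simps)
    qed (use \<theta> in auto)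
    then show ?case
      using insert by (simp add: algebra_simps)
  qed simp
  from this[of UNIV] show ?thesis
    using basis_expansion[of \<theta>] by (simp add: scalar_mult_eq_scaleR)
qed

section \<open>Dual norms\<close>

text \<open>
  A norm on a Euclidean space, given as a function apart from the ambient Euclidean norm.
\<close>

locale norm_functional =
  fixes H :: "'a::euclidean_space \<Rightarrow> real"
  assumes triangle: "H (p + q) \<le> H p + H q"
    and scale: "H (c *\<^sub>R p) = \<bar>c\<bar> * H p"
    and pos: "p \<noteq> 0 \<Longrightarrow> H p > 0"
begin

lemma zero [simp]: "H 0 = 0"
  using scale[of 0 0] by simp

lemma nonneg: "H p \<ge> 0"
  using pos[of p] by (cases "p = 0") auto

lemma upper_bound:
  obtains L where "L > 0" "\<And>p. H p \<le> L * norm p"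
proof
  define L where "L = (\<Sum>b\<in>Basis. H b) + 1"
  show "L > 0"
    unfolding L_def by (intro add_nonneg_pos sum_nonneg nonneg) auto
  show "H p \<le> L * norm p" for p
  proof -
    have sum: "H (\<Sum>b\<in>B. f b) \<le> (\<Sum>b\<in>B. H (f b))" if "finite B" for f and B :: "'a set"
      using that by induction (auto intro: order.trans[OF triangle])
    have "H p = H (\<Sum>b\<in>Basis. (p \<bullet> b) *\<^sub>R b)"
      by (simp add: euclidean_representation)
    also have "\<dots> \<le> (\<Sum>b\<in>Basis. \<bar>p \<bullet> b\<bar> * H b)"
      using sum[OF finite_Basis, of "\<lambda>b. (p \<bullet> b) *\<^sub>R b"] by (simp add: scale)
    also have "\<dots> \<le> (\<Sum>b\<in>Basis. norm p * H b)"
      by (intro sum_mono mult_right_mono Basis_le_norm nonneg)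
    also have "\<dots> = norm p * (\<Sum>b\<in>Basis. H b)"
      by (simp only: sum_distrib_left)
    also have "\<dots> \<le> L * norm p"
      by (simp add: L_def algebra_simps)
    finally show ?thesis .
  qed
qed

lemma continuous: "continuous_on S H"
proof -
  obtain L where L: "L > 0" "\<And>p. H p \<le> L * norm p"
    by (rule upper_bound) blast
  have "\<bar>H p - H q\<bar> \<le> L * norm (p - q)" for p q
    using triangle[of "p - q" q] triangle[of "q - p" p] L(2)[of "p - q"] L(2)[of "q - p"]
    by (simp add: norm_minus_commute)
  then have "L-lipschitz_on S H"
    using L(1) by (intro lipschitz_onI) (auto simp: dist_norm)
  then show ?thesis
    by (rule lipschitz_on_continuous_on)
qed

lemma lower_bound:
  obtains m where "m > 0" "\<And>p. m * norm p \<le> H p"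
proof -
  have "sphere (0::'a) 1 \<noteq> {}" by simp
  then obtain e :: 'a where e: "e \<in> sphere 0 1" "\<And>p. p \<in> sphere 0 1 \<Longrightarrow> H e \<le> H p"
    using continuous_attains_inf[OF compact_sphere _ continuous] by blast
  show thesis
  proof
    show "H e > 0" using e(1) by (intro pos) auto
    show "H e * norm p \<le> H p" for p
    proof (cases "p = 0")
      case False
      then have "H e \<le> H ((1 / norm p) *\<^sub>R p)"
        by (intro e(2)) simp
      then show ?thesis
        using False by (simp add: scale field_simps)
    qed simp
  qed
qed

lemma compact_unit_ball: "compact {p. H p \<le> 1}"
proof -
  obtain m where m: "m > 0" "\<And>p. m * norm p \<le> H p"
    by (rule lower_bound) blast
  have "norm p \<le> 1 / m" if "H p \<le> 1" for p
    using m(2)[of p] m(1) that by (simp add: field_simps)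
  then have "bounded {p. H p \<le> 1}"
    by (auto intro!: boundedI)
  moreover have "closed {p. H p \<le> 1}"
    by (intro closed_Collect_le continuous continuous_intros)
  ultimately show ?thesis
    by (simp add: compact_eq_bounded_closed)
qed

text \<open>The dual norm, that is the support function of the unit ball of \<open>H\<close>.\<close>

definition dual :: "'a \<Rightarrow> real" where
  "dual x = (SUP p \<in> {p. H p \<le> 1}. x \<bullet> p)"

lemma dual_attained: "\<exists>p. H p \<le> 1 \<and> x \<bullet> p = dual x \<and> (\<forall>q. H q \<le> 1 \<longrightarrow> x \<bullet> q \<le> dual x)"
proof -
  have "0 \<in> {p. H p \<le> 1}" by simp
  then have "{p. H p \<le> 1} \<noteq> {}" by blast
  moreover have "continuous_on {p. H p \<le> 1} (\<lambda>p. x \<bullet> p)"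
    by (intro continuous_intros)
  ultimately obtain p where p: "H p \<le> 1" "\<And>q. H q \<le> 1 \<Longrightarrow> x \<bullet> q \<le> x \<bullet> p"
    using continuous_attains_sup[OF compact_unit_ball, of "\<lambda>p. x \<bullet> p"] by blast
  then have "dual x = x \<bullet> p"
    unfolding dual_def by (intro cSup_eq_maximum) auto
  with p show ?thesis by (intro exI[of _ p]) simp
qed

lemma dual_upper: "H q \<le> 1 \<Longrightarrow> x \<bullet> q \<le> dual x"
  using dual_attained[of x] by blast

lemma dual_scale: "c \<ge> 0 \<Longrightarrow> dual (c *\<^sub>R x) = c * dual x"
proof -
  assume c: "c \<ge> 0"
  obtain p where p: "H p \<le> 1" "x \<bullet> p = dual x" using dual_attained by blast
  obtain q where q: "H q \<le> 1" "(c *\<^sub>R x) \<bullet> q = dual (c *\<^sub>R x)" using dual_attained by blast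
  show ?thesis
    using dual_upper[OF p(1), of "c *\<^sub>R x"] mult_left_mono[OF dual_upper[OF q(1), of x] c] p q by simp
qed

lemma dual_lipschitz:
  obtains L where "L > 0" "\<And>x y. \<bar>dual x - dual y\<bar> \<le> L * norm (x - y)"
proof -
  obtain m where m: "m > 0" "\<And>p. m * norm p \<le> H p"
    by (rule lower_bound) blast
  have *: "dual x - dual y \<le> (1 / m) * norm (x - y)" for x y
  proof -
    obtain p where p: "H p \<le> 1" "x \<bullet> p = dual x" using dual_attained by blast
    have "dual x - dual y \<le> x \<bullet> p - y \<bullet> p"
      using p dual_upper[of p y] by simp
    also have "\<dots> \<le> norm (x - y) * norm p"
      by (metis inner_diff_left norm_cauchy_schwarz)
    also have "\<dots> \<le> norm (x - y) * (1 / m)"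
      using m(2)[of p] m(1) p(1) by (intro mult_left_mono) (simp_all add: field_simps)
    finally show ?thesis by simp
  qed
  show thesis
  proof
    show "1 / m > 0" using m by simp
    show "\<bar>dual x - dual y\<bar> \<le> (1 / m) * norm (x - y)" for x y
      using *[of x y] *[of y x] by (simp add: abs_le_iff norm_minus_commute)
  qed
qed

lemma dual_zero [simp]: "dual 0 = 0"
  using dual_scale[of 0 0] by simp

lemma dual_pos:
  assumes "x \<noteq> 0" shows "dual x > 0"
proof -
  have "H ((1 / H x) *\<^sub>R x) = 1"
    using pos[OF assms] by (simp add: scale)
  then have "x \<bullet> ((1 / H x) *\<^sub>R x) \<le> dual x"
    by (intro dual_upper) simp
  moreover have "x \<bullet> ((1 / H x) *\<^sub>R x) > 0"
    using pos[OF assms] assms by (simp add: inner_gt_zero_iff)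
  ultimately show ?thesis by linarith
qed

lemma dual_maximizer_on_sphere:
  assumes "x \<noteq> 0" "H p \<le> 1" "x \<bullet> p = dual x"
  shows "H p = 1"
proof -
  have "p \<noteq> 0" using assms dual_pos[of x] by auto
  then have "H p > 0" by (rule pos)
  then have "x \<bullet> ((1 / H p) *\<^sub>R p) \<le> dual x"
    by (intro dual_upper) (simp add: scale)
  then have "dual x \<le> H p * dual x"
    using assms(3) \<open>H p > 0\<close> by (simp add: field_simps)
  then show ?thesis
    using dual_pos[OF assms(1)] assms(2) by simp
qed

end

text \<open>
  Strict convexity is stated on the unit sphere only: a chord whose midpoint lies on the sphere is
  trivial.
\<close>

locale strictly_convex_norm = norm_functional +
  assumes strict: "H p = 1 \<Longrightarrow> H q = 1 \<Longrightarrow> H (p + q) = 2 \<Longrightarrow> p = q"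
begin

text \<open>
  The point of the unit ball of \<open>H\<close> that is extremal in the direction \<open>x\<close>. It is unique for
  \<open>x \<noteq> 0\<close> and an arbitrary point of the ball for \<open>x = 0\<close>.
\<close>

definition support :: "'a \<Rightarrow> 'a" where
  "support x = (SOME p. H p \<le> 1 \<and> x \<bullet> p = dual x)"

lemma support_le: "H (support x) \<le> 1" and inner_support: "x \<bullet> support x = dual x"
proof -
  have "\<exists>p. H p \<le> 1 \<and> x \<bullet> p = dual x" using dual_attained[of x] by blast
  then have "H (support x) \<le> 1 \<and> x \<bullet> support x = dual x"
    unfolding support_def by (rule someI_ex)
  then show "H (support x) \<le> 1" "x \<bullet> support x = dual x"
    by auto
qed

lemma H_support: "x \<noteq> 0 \<Longrightarrow> H (support x) = 1"
  using dual_maximizer_on_sphere support_le inner_support by blast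

lemma support_unique:
  assumes x: "x \<noteq> 0" and "H p \<le> 1" "x \<bullet> p = dual x"
  shows "p = support x"
proof (rule strict)
  show "H p = 1" "H (support x) = 1"
    using assms dual_maximizer_on_sphere H_support by auto
  let ?q = "(1/2) *\<^sub>R (p + support x)"
  have "H (p + support x) \<le> 2"
    using triangle[of p "support x"] assms(2) support_le[of x] by simp
  then have "H ?q \<le> 1" unfolding scale by simp
  moreover have "x \<bullet> ?q = dual x"
    using assms(3) inner_support[of x] by (simp add: inner_add_right)
  ultimately have "H ?q = 1"
    by (intro dual_maximizer_on_sphere[OF x])
  then show "H (p + support x) = 2"
    unfolding scale by simp
qed

lemma support_scale:
  assumes "c > 0" "x \<noteq> 0" shows "support (c *\<^sub>R x) = support x"
  using assms inner_support[of x] support_le[of x]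
  by (intro support_unique[symmetric]) (auto simp: dual_scale)

text \<open>
  By uniqueness the graph over the unit sphere is closed, and the values lie in a compact set;
  homogeneity of degree zero does the rest.
\<close>

lemma continuous_on_support: "continuous_on (- {0}) support"
proof -
  have "continuous_on (sphere 0 1) support"
  proof (rule continuous_from_closed_graph[OF compact_unit_ball])
    show "support \<in> sphere 0 1 \<rightarrow> {p. H p \<le> 1}"
      using support_le by auto
    obtain L where L: "L > 0" "\<And>x y. \<bar>dual x - dual y\<bar> \<le> L * norm (x - y)"
      by (rule dual_lipschitz) blast
    have cd: "continuous_on UNIV dual"
      using L by (intro lipschitz_on_continuous_on[of L] lipschitz_onI) (auto simp: dist_norm)
    have "(\<lambda>x. (x, support x)) ` sphere 0 1
        = {z. norm (fst z) = 1} \<inter> {z. H (snd z) \<le> 1} \<inter> {z. fst z \<bullet> snd z = dual (fst z)}"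
    proof (intro equalityI subsetI)
      fix z :: "'a \<times> 'a"
      assume "z \<in> {z. norm (fst z) = 1} \<inter> {z. H (snd z) \<le> 1} \<inter> {z. fst z \<bullet> snd z = dual (fst z)}"
      then have "norm (fst z) = 1" "snd z = support (fst z)"
        by (auto intro!: support_unique)
      then show "z \<in> (\<lambda>x. (x, support x)) ` sphere 0 1"
        by (intro image_eqI[of _ _ "fst z"]) (auto simp: prod_eq_iff)
    qed (auto simp: support_le inner_support)
    moreover have "closed \<dots>"
      by (intro closed_Int closed_Collect_eq closed_Collect_le continuous_intros
          continuous_on_compose2[OF continuous] continuous_on_compose2[OF cd]) auto
    ultimately show "closed ((\<lambda>x. (x, support x)) ` sphere 0 1)" by simp
  qed
  then have "continuous_on (- {0}) (\<lambda>x. support ((1 / norm x) *\<^sub>R x))"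
    by (rule continuous_on_compose2) (auto intro!: continuous_intros split: if_splits)
  then show ?thesis
    by (rule continuous_on_eq) (auto intro: support_scale)
qed

lemma GDERIV_dual:
  assumes "x \<noteq> 0" shows "GDERIV dual x :> support x"
  unfolding gderiv_def has_derivative_at_alt
proof (intro conjI allI impI)
  show "bounded_linear (\<lambda>h. h \<bullet> support x)" by (rule bounded_linear_inner_left)
  fix e :: real assume "e > 0"
  have "isCont support x"
    using continuous_on_support assms
    by (simp add: continuous_on_eq_continuous_at open_Compl)
  then obtain d0 where "d0 > 0" and d0: "\<And>y. norm (y - x) < d0 \<Longrightarrow> norm (support y - support x) < e"
    using \<open>e > 0\<close> unfolding continuous_at_eps_delta dist_norm by blast
  have "norm (dual y - dual x - (y - x) \<bullet> support x) \<le> e * norm (y - x)"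
    if y: "norm (y - x) < d0" for y
  proof -
    \<comment> \<open>each of the two extremal points is a competitor in the maximum that defines the other value\<close>
    have lower: "0 \<le> dual y - dual x - (y - x) \<bullet> support x"
      using dual_upper[OF support_le[of x], of y] inner_support[of x] by (simp add: inner_diff_left)
    have "dual y - dual x - (y - x) \<bullet> support x \<le> (y - x) \<bullet> (support y - support x)"
      using dual_upper[OF support_le[of y], of x] inner_support[of y]
      by (simp add: inner_diff_left inner_diff_right)
    also have "\<dots> \<le> norm (y - x) * norm (support y - support x)"
      by (rule norm_cauchy_schwarz)
    also have "\<dots> \<le> norm (y - x) * e"
      using d0[OF y] by (intro mult_left_mono) auto
    finally show ?thesis using lower by (simp add: mult.commute)
  qed
  then show "\<exists>d>0. \<forall>y. norm (y - x) < d \<longrightarrow>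
      norm (dual y - dual x - (y - x) \<bullet> support x) \<le> e * norm (y - x)"
    using \<open>d0 > 0\<close> by blast
qed

lemma gradient_dual:
  assumes "x \<noteq> 0" shows "gradient dual x = support x"
  unfolding gradient_def
proof (rule the_equality)
  show "GDERIV dual x :> support x" by (rule GDERIV_dual[OF assms])
  fix D assume "GDERIV dual x :> D"
  then have "(\<lambda>h. h \<bullet> D) = (\<lambda>h. h \<bullet> support x)"
    using GDERIV_dual[OF assms] unfolding gderiv_def by (rule has_derivative_unique)
  then have "(D - support x) \<bullet> D = (D - support x) \<bullet> support x"
    by (rule fun_cong)
  then have "(D - support x) \<bullet> (D - support x) = 0"
    by (simp add: inner_diff_right)
  then show "D = support x" by simp
qed

text \<open>
  Since \<open>support\<close> is homogeneous of degree zero, a displacement of bounded size far from the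
  origin hardly changes it.
\<close>

lemma support_slowly_varying:
  assumes "\<epsilon> > 0"
  obtains C where "C > 0"
    "\<And>x y. dual x \<ge> C \<Longrightarrow> y \<noteq> 0 \<Longrightarrow> norm (y - x) \<le> K \<Longrightarrow> norm (support y - support x) \<le> \<epsilon>"
proof -
  have "uniformly_continuous_on (sphere 0 1) support"
    by (intro compact_uniformly_continuous continuous_on_subset[OF continuous_on_support]) auto
  then obtain \<delta> where "\<delta> > 0" and \<delta>: "\<And>x y. norm x = 1 \<Longrightarrow> norm y = 1 \<Longrightarrow> norm (y - x) < \<delta>
      \<Longrightarrow> norm (support y - support x) < \<epsilon>"
    using uniformly_continuous_onE[OF _ \<open>\<epsilon> > 0\<close>, of "sphere 0 1" support]
    by (metis dist_norm mem_sphere_0)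
  obtain L where L: "L > 0" "\<And>x y. \<bar>dual x - dual y\<bar> \<le> L * norm (x - y)"
    by (rule dual_lipschitz) blast
  define C where "C = L * (2 * \<bar>K\<bar> + 1) / \<delta>"
  show thesis
  proof
    show "C > 0" using L(1) \<open>\<delta> > 0\<close> by (simp add: C_def)
    fix x y assume x: "dual x \<ge> C" and "y \<noteq> 0" and xy: "norm (y - x) \<le> K"
    have "dual x > 0" using x \<open>C > 0\<close> by simp
    then have "x \<noteq> 0" by auto
    let ?u = "(1 / norm x) *\<^sub>R x" and ?v = "(1 / norm y) *\<^sub>R y"
    have "C \<le> L * norm x" using L(2)[of x 0] x by simp
    then have "L * (2 * \<bar>K\<bar> + 1) \<le> L * (\<delta> * norm x)"
      using \<open>\<delta> > 0\<close> by (simp add: C_def field_simps)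
    then have nx: "2 * K + 1 \<le> \<delta> * norm x"
      using L(1) by simp
    have "norm (?v - ?u) * norm x = norm (norm x *\<^sub>R (?v - ?u))"
      by simp
    also have "norm x *\<^sub>R (?v - ?u) = (y - x) + (norm x - norm y) *\<^sub>R ?v"
      using \<open>x \<noteq> 0\<close> \<open>y \<noteq> 0\<close> by (simp add: algebra_simps)
    also have "norm \<dots> \<le> norm (y - x) + \<bar>norm x - norm y\<bar>"
      using \<open>y \<noteq> 0\<close> by (intro order.trans[OF norm_triangle_ineq]) simp
    also have "\<dots> \<le> 2 * norm (y - x)"
      using norm_triangle_ineq3[of x y] by (simp add: norm_minus_commute)
    also have "\<dots> < \<delta> * norm x" using xy nx by simp
    finally have "norm (?v - ?u) < \<delta>" using \<open>x \<noteq> 0\<close> by simp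
    then have "norm (support ?v - support ?u) < \<epsilon>"
      using \<open>x \<noteq> 0\<close> \<open>y \<noteq> 0\<close> by (intro \<delta>) auto
    then show "norm (support y - support x) \<le> \<epsilon>"
      using \<open>x \<noteq> 0\<close> \<open>y \<noteq> 0\<close> by (simp add: support_scale)
  qed
qed

end

section \<open>Strict convexity of the averaged norm\<close>

text \<open>
  Two linear functionals that never have opposite signs are positively proportional, unless one of
  them vanishes.
\<close>

lemma parallel_of_same_sign:
  fixes P Q :: "'a::real_inner"
  assumes "\<And>u. (P \<bullet> u) * (Q \<bullet> u) \<ge> 0"
  shows "norm Q *\<^sub>R P = norm P *\<^sub>R Q"
proof -
  let ?d = "norm P * norm Q - P \<bullet> Q"
  let ?u = "norm Q *\<^sub>R P - norm P *\<^sub>R Q"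
  have "P \<bullet> ?u = norm P * ?d" "Q \<bullet> ?u = - (norm Q * ?d)"
    by (simp_all add: inner_diff_right dot_square_norm power2_eq_square algebra_simps inner_commute)
  then have "norm P * norm Q * ?d\<^sup>2 \<le> 0"
    using assms[of ?u] by (simp add: power2_eq_square mult_ac)
  moreover have "norm P * norm Q * ?d\<^sup>2 \<ge> 0" by simp
  ultimately have "norm P * norm Q * ?d\<^sup>2 = 0" by (rule antisym)
  then have "P = 0 \<or> Q = 0 \<or> P \<bullet> Q = norm P * norm Q" by auto
  then show ?thesis
    by (auto simp: norm_cauchy_schwarz_eq)
qed

text \<open>
  The same conclusion when the functionals are compared on a product of unit circles only. Fix all
  angles but the \<open>i\<close>-th so that the other terms of the first functional vanish; reversing these
  angles changes the sign of the rest of the second functional, and averaging removes it. So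
  \<open>Z i\<close> and \<open>W i\<close> point in one direction \<open>e i\<close>. As \<open>u i\<close> runs over the circle,
  \<open>e i \<bullet> u i\<close> takes all values in \<open>[-1, 1]\<close>, independently for different \<open>i\<close>, so that by
  scaling the vectors of moduli satisfy the hypothesis of the preceding lemma.
\<close>

lemma proportional_of_same_sign:
  fixes Z W :: "'n::finite \<Rightarrow> complex"
  assumes sign: "\<And>u. (\<And>i. norm (u i) = 1) \<Longrightarrow>
                  (\<Sum>i\<in>UNIV. Z i \<bullet> u i) * (\<Sum>i\<in>UNIV. W i \<bullet> u i) \<ge> 0"
    and W: "W k \<noteq> 0"
  obtains c where "c \<ge> 0" "\<And>i. Z i = c *\<^sub>R W i"
proof -
  have single: "(Z i \<bullet> u) * (W i \<bullet> u) \<ge> 0" for i u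
  proof (cases "u = 0")
    case False
    \<comment> \<open>\<open>e j\<close> is a unit vector orthogonal to \<open>Z j\<close>\<close>
    define e where "e j = (if Z j = 0 then 1 else \<i> * sgn (Z j))" for j
    have e: "norm (e j) = 1" "Z j \<bullet> e j = 0" for j
      by (auto simp: e_def norm_mult norm_sgn sgn_div_norm inner_complex_def)
    define r where "r = (\<Sum>j\<in>UNIV - {i}. W j \<bullet> e j)"
    have "(Z i \<bullet> sgn u) * (W i \<bullet> sgn u + s * r) \<ge> 0" if s: "\<bar>s\<bar> = 1" for s
    proof -
      let ?U = "\<lambda>j. if j = i then sgn u else s *\<^sub>R e j"
      have "(\<Sum>j\<in>UNIV. Z j \<bullet> ?U j) = Z i \<bullet> sgn u"
        by (simp add: sum.remove[of UNIV i] e)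
      moreover have "(\<Sum>j\<in>UNIV. W j \<bullet> ?U j) = W i \<bullet> sgn u + s * r"
        by (simp add: sum.remove[of UNIV i] r_def sum_distrib_left)
      moreover have "norm (?U j) = 1" for j
        using False s e by (simp add: norm_sgn)
      ultimately show ?thesis
        using sign[of ?U] by metis
    qed
    from this[of 1] this[of "-1"] have "(Z i \<bullet> sgn u) * (W i \<bullet> sgn u) \<ge> 0"
      by (simp add: algebra_simps)
    then have "(norm u)\<^sup>2 * ((Z i \<bullet> sgn u) * (W i \<bullet> sgn u)) \<ge> 0" by simp
    moreover have "u = norm u *\<^sub>R sgn u" using False by (simp add: sgn_div_norm)
    ultimately show ?thesis
      by (metis (no_types, lifting) inner_scaleR_right mult.assoc mult.left_commute power2_eq_square)
  qed simp
  have par: "norm (W i) *\<^sub>R Z i = norm (Z i) *\<^sub>R W i" for i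
    by (rule parallel_of_same_sign) (rule single)
  define e where "e i = (if Z i \<noteq> 0 then sgn (Z i) else if W i \<noteq> 0 then sgn (W i) else 1)" for i
  have e1: "norm (e i) = 1" for i
    by (simp add: e_def norm_sgn)
  have Ze: "Z i = norm (Z i) *\<^sub>R e i" for i
    by (simp add: e_def sgn_div_norm)
  have We: "W i = norm (W i) *\<^sub>R e i" for i
  proof (cases "Z i = 0")
    case False
    then have "W i = (1 / norm (Z i)) *\<^sub>R (norm (W i) *\<^sub>R Z i)"
      by (simp add: par)
    then show ?thesis using False by (simp add: e_def sgn_div_norm mult.commute divide_inverse)
  qed (simp add: e_def sgn_div_norm)
  define zv wv :: "real ^ 'n" where "zv = (\<chi> i. norm (Z i))" and "wv = (\<chi> i. norm (W i))"
  have "(zv \<bullet> s) * (wv \<bullet> s) \<ge> 0" for s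
  proof -
    define M where "M = 1 + norm s"
    define t where "t i = s $ i / M" for i
    have "M > 0" unfolding M_def by (simp add: add_pos_nonneg)
    have t: "\<bar>t i\<bar> \<le> 1" for i
      using component_le_norm_cart[of s i] \<open>M > 0\<close> by (simp add: t_def M_def abs_divide divide_le_eq)
    \<comment> \<open>a unit vector whose component along \<open>e i\<close> is \<open>t i\<close>\<close>
    define u where "u i = e i * Complex (t i) (sqrt (1 - (t i)\<^sup>2))" for i
    have eu: "e i \<bullet> u i = t i" for i
    proof -
      have "e i \<bullet> u i = (norm (e i))\<^sup>2 * t i"
        unfolding cmod_power2 by (simp add: u_def inner_complex_def power2_eq_square algebra_simps)
      then show ?thesis using e1 by simp
    qed
    have "norm (Complex (t i) (sqrt (1 - (t i)\<^sup>2))) = 1" for i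
      using t[of i] by (simp add: cmod_def abs_square_le_1)
    then have "norm (u i) = 1" for i
      by (simp only: u_def norm_mult e1)
    then have "(\<Sum>i\<in>UNIV. Z i \<bullet> u i) * (\<Sum>i\<in>UNIV. W i \<bullet> u i) \<ge> 0"
      by (rule sign)
    moreover have "Z i \<bullet> u i = norm (Z i) * t i" "W i \<bullet> u i = norm (W i) * t i" for i
      using Ze[of i] We[of i] eu[of i] by (metis inner_scaleR_left)+
    moreover have "(\<Sum>i\<in>UNIV. norm (Z i) * t i) = (zv \<bullet> s) / M" "(\<Sum>i\<in>UNIV. norm (W i) * t i) = (wv \<bullet> s) / M"
      by (simp_all add: zv_def wv_def inner_vec_def t_def sum_divide_distrib)
    ultimately show ?thesis
      using \<open>M > 0\<close> mult_pos_pos[OF \<open>M > 0\<close> \<open>M > 0\<close>] by (simp add: zero_le_divide_iff)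
  qed
  then have zw: "norm wv *\<^sub>R zv = norm zv *\<^sub>R wv"
    by (rule parallel_of_same_sign)
  have "wv $ k \<noteq> 0" using W by (simp add: wv_def)
  then have "norm wv > 0" by auto
  have norms: "norm (Z i) = (norm zv / norm wv) * norm (W i)" for i
    using arg_cong[OF zw, of "\<lambda>v. v $ i"] \<open>norm wv > 0\<close> by (simp add: zv_def wv_def field_simps)
  show thesis
  proof
    show "norm zv / norm wv \<ge> 0" by simp
    show "Z i = (norm zv / norm wv) *\<^sub>R W i" for i
      using Ze[of i] We[of i] norms[of i] by (metis scaleR_scaleR)
  qed
qed

text \<open>
  A trigonometric sum on the torus with one harmonic in each angle; \<open>Z i\<close> carries amplitude and
  phase of the \<open>i\<close>-th term.
\<close>

definition torus_sum :: "('n::finite \<Rightarrow> complex) \<Rightarrow> real ^ 'n \<Rightarrow> real" where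
  "torus_sum Z \<phi> = (\<Sum>i\<in>UNIV. Z i \<bullet> cis (\<phi> $ i))"

text \<open>
  The pair \<open>(\<xi>\<^sub>i, \<eta>\<^sub>i)\<close> as the complex number \<open>\<eta>\<^sub>i + \<i> \<xi>\<^sub>i / \<omega>\<^sub>i\<close>, whose modulus is the amplitude
  \<open>z\<^sub>i\<close>.
\<close>

definition dual_phasor :: "('n \<Rightarrow> real) \<Rightarrow> 'n::finite phase \<Rightarrow> 'n \<Rightarrow> complex" where
  "dual_phasor \<omega> p i = Complex (snd (p $ i)) (fst (p $ i) / \<omega> i)"

text \<open>The torus is represented by its closed fundamental domain.\<close>

abbreviation torus :: "(real ^ 'n) set" where
  "torus \<equiv> cbox 0 (\<chi> i. 2 * pi)"

lemma continuous_on_torus_sum [continuous_intros]: "continuous_on S (torus_sum Z)"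
  unfolding torus_sum_def by (intro continuous_intros)

lemma torus_sum_integrable: "(\<lambda>\<phi>. \<bar>torus_sum Z \<phi>\<bar>) integrable_on cbox a b"
  by (intro integrable_continuous continuous_intros)

lemma torus_angles:
  assumes "\<And>i. norm (u i) = 1"
  obtains \<phi> :: "real ^ 'n" where "\<phi> \<in> torus" "\<And>i. cis (\<phi> $ i) = u i"
proof
  have nz: "u i \<noteq> 0" for i using assms[of i] by auto
  show "(\<chi> i. Arg2pi (u i)) \<in> torus"
    using Arg2pi_ge_0 Arg2pi_lt_2pi by (auto simp: mem_box_cart less_imp_le)
  show "cis ((\<chi> i. Arg2pi (u i)) $ i) = u i" for i
    using Arg2pi_eq[of "u i"] assms[of i] by (simp add: cis_conv_exp)
qed

lemma amplitude_eq_norm_dual_phasor: "amplitude \<omega> p i = norm (dual_phasor \<omega> p i)"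
  by (simp add: amplitude_def dual_phasor_def cmod_def power_divide)

text \<open>
  Translation of the angles turns the cosines with amplitudes into a sum that depends linearly on
  \<open>p\<close>; this makes the norm properties visible.
\<close>

lemma Hnorm_eq_integral_torus_sum:
  "Hnorm \<omega> p = integral torus (\<lambda>\<phi>. \<bar>torus_sum (dual_phasor \<omega> p) \<phi>\<bar>) / (2 * pi) ^ CARD('n)"
  for p :: "'n::finite phase"
proof -
  let ?Z = "dual_phasor \<omega> p"
  define \<theta> :: "real ^ 'n" where "\<theta> = (\<chi> i. Arg2pi (?Z i))"
  have shift: "amplitude \<omega> p i * cos (\<phi> $ i) = ?Z i \<bullet> cis ((\<phi> + \<theta>) $ i)" for \<phi> i
  proof -
    have "?Z i = norm (?Z i) *\<^sub>R cis (\<theta> $ i)"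
      using Arg2pi_eq[of "?Z i"] by (simp add: \<theta>_def cis_conv_exp scaleR_conv_of_real)
    then have "?Z i \<bullet> cis ((\<phi> + \<theta>) $ i) = norm (?Z i) * (cis (\<theta> $ i) \<bullet> cis ((\<phi> + \<theta>) $ i))"
      by (metis inner_scaleR_left)
    also have "cis (\<theta> $ i) \<bullet> cis ((\<phi> + \<theta>) $ i) = cos (\<phi> $ i)"
      using cos_diff[of "\<theta> $ i + \<phi> $ i" "\<theta> $ i"] by (simp add: inner_complex_def algebra_simps)
    finally show ?thesis by (simp add: amplitude_eq_norm_dual_phasor)
  qed
  have "(LINT \<phi> : torus | lborel. \<bar>\<Sum>i\<in>UNIV. amplitude \<omega> p i * cos (\<phi> $ i)\<bar>)
      = integral torus (\<lambda>\<phi>. \<bar>\<Sum>i\<in>UNIV. amplitude \<omega> p i * cos (\<phi> $ i)\<bar>)"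
  proof (rule set_borel_integral_eq_integral)
    show "set_integrable lborel (torus :: (real ^ 'n) set) (\<lambda>\<phi>. \<bar>\<Sum>i\<in>UNIV. amplitude \<omega> p i * cos (\<phi> $ i)\<bar>)"
      unfolding set_integrable_def
      by (rule borel_integrable_compact) (auto intro!: continuous_intros)
  qed
  also have "\<dots> = integral torus (\<lambda>\<phi>. \<bar>torus_sum ?Z (\<phi> + \<theta>)\<bar>)"
    by (simp only: shift torus_sum_def)
  also have "\<dots> = integral torus (\<lambda>\<phi>. \<bar>torus_sum ?Z \<phi>\<bar>)"
  proof (rule integral_torus_shift)
    show "continuous_on UNIV (\<lambda>\<phi>. \<bar>torus_sum ?Z \<phi>\<bar>)" by (intro continuous_intros)
    show "\<bar>torus_sum ?Z (\<phi> + (2 * pi) *\<^sub>R axis i 1)\<bar> = \<bar>torus_sum ?Z \<phi>\<bar>" for \<phi> i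
    proof -
      have "cis ((\<phi> + (2 * pi) *\<^sub>R axis i 1) $ j) = cis (\<phi> $ j)" for j
        by (auto simp: axis_def complex_eq_iff)
      then show ?thesis by (simp add: torus_sum_def)
    qed
    show "0 \<le> \<theta> $ i \<and> \<theta> $ i \<le> 2 * pi" for i
      by (simp add: \<theta>_def Arg2pi_ge_0 Arg2pi_lt_2pi less_imp_le)
  qed
  finally show ?thesis by (simp add: Hnorm_def)
qed

lemma dual_phasor_add: "dual_phasor \<omega> (p + q) i = dual_phasor \<omega> p i + dual_phasor \<omega> q i"
  by (simp add: dual_phasor_def add_divide_distrib complex_eq_iff)

lemma dual_phasor_scaleR: "dual_phasor \<omega> (c *\<^sub>R p) i = c *\<^sub>R dual_phasor \<omega> p i"
  by (simp add: dual_phasor_def complex_eq_iff)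

lemma dual_phasor_inject:
  assumes "\<And>i. \<omega> i > 0" "\<And>i. dual_phasor \<omega> p i = dual_phasor \<omega> q i"
  shows "p = q"
proof -
  have "\<omega> i \<noteq> 0" for i using assms(1)[of i] by simp
  then show ?thesis
    using assms(2) by (auto simp: vec_eq_iff dual_phasor_def complex_eq_iff prod_eq_iff)
qed

lemma torus_sum_add: "torus_sum (dual_phasor \<omega> (p + q)) \<phi> = torus_sum (dual_phasor \<omega> p) \<phi> + torus_sum (dual_phasor \<omega> q) \<phi>"
  by (simp add: torus_sum_def dual_phasor_add inner_add_left sum.distrib)

lemma torus_sum_scaleR: "torus_sum (dual_phasor \<omega> (c *\<^sub>R p)) \<phi> = c * torus_sum (dual_phasor \<omega> p) \<phi>"
  by (simp add: torus_sum_def dual_phasor_scaleR sum_distrib_left)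

lemma zero_of_integral_torus_zero:
  fixes f :: "real ^ 'n \<Rightarrow> real"
  assumes "continuous_on UNIV f" "\<And>\<phi>. f \<phi> \<ge> 0" "integral torus f = 0" "\<phi> \<in> torus"
  shows "f \<phi> = 0"
proof (rule has_integral_0_cbox_imp_0[where f = f and a = 0 and b = "\<chi> i. 2 * pi"])
  show "continuous_on torus f" using assms(1) by (rule continuous_on_subset) simp
  then show "(f has_integral 0) torus"
    using assms(3) integrable_continuous integrable_integral by metis
  have "(\<chi> i. pi) \<in> box 0 (\<chi> i. 2 * pi :: real ^ 'n)" by (simp add: mem_box_cart)
  then show "box 0 (\<chi> i. 2 * pi :: real ^ 'n) \<noteq> {}" by blast
qed (use assms in auto)

text \<open>
  Equality in the triangle inequality forces the continuous sums of \<open>p\<close> and \<open>q\<close> to have the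
  same sign everywhere on the torus, hence \<open>p\<close> and \<open>q\<close> to be proportional.
\<close>

lemma strictly_convex_norm_Hnorm:
  fixes \<omega> :: "'n::finite \<Rightarrow> real"
  assumes \<omega>: "\<And>i. \<omega> i > 0"
  shows "strictly_convex_norm (Hnorm \<omega>)"
proof
  let ?f = "\<lambda>p. torus_sum (dual_phasor \<omega> p)"
  let ?I = "\<lambda>p. integral torus (\<lambda>\<phi>. \<bar>?f p \<phi>\<bar>)"
  have H: "Hnorm \<omega> p = ?I p / (2 * pi) ^ CARD('n)" for p :: "'n phase"
    by (rule Hnorm_eq_integral_torus_sum)
  have N: "(2 * pi) ^ CARD('n) > 0" by simp
  fix p q :: "'n phase"
  have "?I (p + q) \<le> integral torus (\<lambda>\<phi>. \<bar>?f p \<phi>\<bar> + \<bar>?f q \<phi>\<bar>)"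
    by (intro integral_le integrable_add torus_sum_integrable) (simp add: torus_sum_add)
  also have "\<dots> = ?I p + ?I q"
    by (intro integral_add torus_sum_integrable)
  finally have "?I (p + q) \<le> ?I p + ?I q" .
  then show "Hnorm \<omega> (p + q) \<le> Hnorm \<omega> p + Hnorm \<omega> q"
    using N by (simp only: H add_divide_distrib[symmetric]) (simp add: divide_right_mono)
  show "Hnorm \<omega> (c *\<^sub>R p) = \<bar>c\<bar> * Hnorm \<omega> p" for c
    by (simp add: H torus_sum_scaleR abs_mult)
  show "Hnorm \<omega> p > 0" if "p \<noteq> 0"
  proof (rule ccontr)
    assume "\<not> Hnorm \<omega> p > 0"
    moreover have "?I p \<ge> 0" by (intro integral_nonneg torus_sum_integrable) simp
    ultimately have "?I p = 0" using N by (simp add: H zero_less_divide_iff)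
    then have zero: "?f p \<phi> = 0" if "\<phi> \<in> torus" for \<phi>
      using zero_of_integral_torus_zero[of "\<lambda>\<phi>. \<bar>?f p \<phi>\<bar>" \<phi>] that
      by (auto intro!: continuous_intros)
    define u where "u i = (if dual_phasor \<omega> p i = 0 then 1 else sgn (dual_phasor \<omega> p i))" for i
    obtain \<phi> :: "real ^ 'n" where "\<phi> \<in> torus" "\<And>i. cis (\<phi> $ i) = u i"
      by (rule torus_angles[of u]) (auto simp: u_def norm_sgn)
    then have "(\<Sum>i\<in>UNIV. dual_phasor \<omega> p i \<bullet> u i) = 0"
      using zero[of \<phi>] by (simp add: torus_sum_def)
    moreover have "dual_phasor \<omega> p i \<bullet> u i = norm (dual_phasor \<omega> p i)" for i
      by (auto simp: u_def sgn_div_norm dot_square_norm power2_eq_square)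
    ultimately have "dual_phasor \<omega> p i = 0" for i
      by (simp add: sum_nonneg_eq_0_iff)
    then have "dual_phasor \<omega> p i = dual_phasor \<omega> 0 i" for i
      by (simp add: dual_phasor_def complex_eq_iff)
    then have "p = 0"
      by (rule dual_phasor_inject[OF \<omega>])
    with that show False by simp
  qed
  show "p = q" if "Hnorm \<omega> p = 1" "Hnorm \<omega> q = 1" "Hnorm \<omega> (p + q) = 2"
  proof -
    let ?g = "\<lambda>\<phi>. \<bar>?f p \<phi>\<bar> + \<bar>?f q \<phi>\<bar> - \<bar>?f (p + q) \<phi>\<bar>"
    have "?I p + ?I q - ?I (p + q) = 0"
      using that N by (simp add: H field_simps)
    then have int: "integral torus ?g = 0"
      by (simp add: integral_diff integral_add integrable_add torus_sum_integrable)
    have g0: "?g \<phi> = 0" if "\<phi> \<in> torus" for \<phi>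
    proof (rule zero_of_integral_torus_zero[where f = ?g, OF _ _ int that])
      show "continuous_on UNIV ?g" by (intro continuous_intros)
      show "?g \<phi> \<ge> 0" for \<phi>
        using abs_triangle_ineq[of "?f p \<phi>" "?f q \<phi>"] by (simp only: torus_sum_add)
    qed
    have same_sign: "(\<Sum>i\<in>UNIV. dual_phasor \<omega> p i \<bullet> u i) * (\<Sum>i\<in>UNIV. dual_phasor \<omega> q i \<bullet> u i) \<ge> 0"
      if u: "\<And>i. norm (u i) = 1" for u
    proof -
      obtain \<phi> :: "real ^ 'n" where "\<phi> \<in> torus" "\<And>i. cis (\<phi> $ i) = u i"
        using torus_angles[of u] u by blast
      moreover have "a * b \<ge> 0" if "\<bar>a\<bar> + \<bar>b\<bar> - \<bar>a + b\<bar> = 0" for a b :: real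
        using that by (cases "a \<ge> 0"; cases "b \<ge> 0") (auto simp: mult_nonneg_nonneg mult_nonpos_nonpos)
      ultimately show ?thesis
        using g0[of \<phi>] by (simp add: torus_sum_add) (simp add: torus_sum_def)
    qed
    have "\<exists>k. dual_phasor \<omega> q k \<noteq> 0"
    proof (rule ccontr)
      assume "\<not> (\<exists>k. dual_phasor \<omega> q k \<noteq> 0)"
      then have "Hnorm \<omega> q = 0" by (simp add: H torus_sum_def)
      with that show False by simp
    qed
    then obtain k where "dual_phasor \<omega> q k \<noteq> 0" by blast
    with same_sign obtain c where "c \<ge> 0" and c: "\<And>i. dual_phasor \<omega> p i = c *\<^sub>R dual_phasor \<omega> q i"
      using proportional_of_same_sign[of "dual_phasor \<omega> p" "dual_phasor \<omega> q" k] by blast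
    have "p = c *\<^sub>R q"
      using \<omega> by (rule dual_phasor_inject[of \<omega> p "c *\<^sub>R q"]) (simp add: c dual_phasor_scaleR)
    then have "Hnorm \<omega> p = c * Hnorm \<omega> q"
      using \<open>c \<ge> 0\<close> by (simp add: H torus_sum_scaleR abs_mult)
    then show ?thesis
      using that \<open>p = c *\<^sub>R q\<close> by simp
  qed
qed

section \<open>Linear independence of harmonics\<close>

lemma DERIV_trig_sum:
  "((\<lambda>s. \<Sum>i\<in>S. \<alpha> i * cos (\<omega> i * s) + \<beta> i * sin (\<omega> i * s)) has_real_derivative
    (\<Sum>i\<in>S. (\<omega> i * \<beta> i) * cos (\<omega> i * s) + (- \<omega> i * \<alpha> i) * sin (\<omega> i * s))) (at s)"
  by (auto intro!: derivative_eq_intros sum.cong simp: algebra_simps)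

lemma trig_sum_derivative_zero:
  assumes "\<And>s. s \<in> {0<..<1::real} \<Longrightarrow> (\<Sum>i\<in>S. \<alpha> i * cos (\<omega> i * s) + \<beta> i * sin (\<omega> i * s)) = 0"
    and s: "s \<in> {0<..<1}"
  shows "(\<Sum>i\<in>S. (\<omega> i * \<beta> i) * cos (\<omega> i * s) + (- \<omega> i * \<alpha> i) * sin (\<omega> i * s)) = 0"
proof -
  have "((\<lambda>s. \<Sum>i\<in>S. \<alpha> i * cos (\<omega> i * s) + \<beta> i * sin (\<omega> i * s)) has_real_derivative 0) (at s)"
    by (rule has_field_derivative_transform_within_open[of "\<lambda>s. 0" 0 s "{0<..<1}"]) (use assms in auto)
  then show ?thesis
    using DERIV_trig_sum DERIV_unique by blast
qed

lemma rotation_zero: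
  fixes a b c s :: real
  assumes 1: "a * c + b * s = 0" and 2: "b * c - a * s = 0" and cs: "c * c + s * s = 1"
  shows "a = 0 \<and> b = 0"
proof -
  have "a * (c * c + s * s) = (a * c + b * s) * c - (b * c - a * s) * s"
    "b * (c * c + s * s) = (a * c + b * s) * s + (b * c - a * s) * c"
    by (simp_all add: algebra_simps)
  then show ?thesis unfolding 1 2 cs by simp
qed

text \<open>
  Harmonics of distinct positive frequencies are linearly independent on an interval. The
  operator \<open>d\<^sup>2/ds\<^sup>2 + (\<omega> j)\<^sup>2\<close> annihilates the \<open>j\<close>-th harmonic and multiplies the others by
  non-zero constants, which permits induction on the number of frequencies.
\<close>

lemma trig_sum_coefficients_zero:
  fixes \<omega> :: "'i \<Rightarrow> real"
  assumes "finite S" "inj_on \<omega> S" "\<And>i. i \<in> S \<Longrightarrow> \<omega> i > 0"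
    and "\<And>s. s \<in> {0<..<1::real} \<Longrightarrow> (\<Sum>i\<in>S. \<alpha> i * cos (\<omega> i * s) + \<beta> i * sin (\<omega> i * s)) = 0"
    and "k \<in> S"
  shows "\<alpha> k = 0 \<and> \<beta> k = 0"
  using assms
proof (induction S arbitrary: \<alpha> \<beta> k rule: finite_induct)
  case (insert j S)
  let ?g = "\<lambda>s i. \<alpha> i * cos (\<omega> i * s) + \<beta> i * sin (\<omega> i * s)"
  note zero = insert.prems(3)
  note zero1 = trig_sum_derivative_zero[OF zero]
  have others: "\<alpha> i = 0 \<and> \<beta> i = 0" if i: "i \<in> S" for i
  proof -
    have "(\<Sum>i\<in>S. ((\<omega> j)\<^sup>2 - (\<omega> i)\<^sup>2) * \<alpha> i * cos (\<omega> i * s) + ((\<omega> j)\<^sup>2 - (\<omega> i)\<^sup>2) * \<beta> i * sin (\<omega> i * s)) = 0"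
      if s: "s \<in> {0<..<1}" for s
    proof -
      have "0 = (\<omega> j)\<^sup>2 * (\<Sum>i\<in>insert j S. ?g s i)
          + (\<Sum>i\<in>insert j S. (\<omega> i * (- \<omega> i * \<alpha> i)) * cos (\<omega> i * s) + (- \<omega> i * (\<omega> i * \<beta> i)) * sin (\<omega> i * s))"
        using zero[OF s] trig_sum_derivative_zero[OF zero1 s] by simp
      also have "\<dots> = (\<Sum>i\<in>insert j S. ((\<omega> j)\<^sup>2 - (\<omega> i)\<^sup>2) * \<alpha> i * cos (\<omega> i * s) + ((\<omega> j)\<^sup>2 - (\<omega> i)\<^sup>2) * \<beta> i * sin (\<omega> i * s))"
        unfolding sum_distrib_left sum.distrib[symmetric]
        by (intro sum.cong refl) (simp add: algebra_simps power2_eq_square)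
      finally show ?thesis using insert.hyps by simp
    qed
    then have "((\<omega> j)\<^sup>2 - (\<omega> i)\<^sup>2) * \<alpha> i = 0 \<and> ((\<omega> j)\<^sup>2 - (\<omega> i)\<^sup>2) * \<beta> i = 0"
      using insert.prems(1,2) i
      by (intro insert.IH[of "\<lambda>i. ((\<omega> j)\<^sup>2 - (\<omega> i)\<^sup>2) * \<alpha> i" "\<lambda>i. ((\<omega> j)\<^sup>2 - (\<omega> i)\<^sup>2) * \<beta> i"]) auto
    moreover have "(\<omega> j)\<^sup>2 \<noteq> (\<omega> i)\<^sup>2"
    proof -
      have "\<omega> j \<noteq> \<omega> i" using insert.prems(1) insert.hyps i by (auto simp: inj_on_def)
      then show ?thesis
        using insert.prems(2)[of i] insert.prems(2)[of j] i by (auto simp: power2_eq_iff)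
    qed
    ultimately show ?thesis by simp
  qed
  show ?case
  proof (cases "k = j")
    case True
    let ?c = "cos (\<omega> j * (1/2))" and ?s = "sin (\<omega> j * (1/2))"
    have 1: "\<alpha> j * ?c + \<beta> j * ?s = 0"
      using zero[of "1/2"] others insert.hyps by simp
    have "(\<omega> j * \<beta> j) * ?c + (- \<omega> j * \<alpha> j) * ?s = 0"
      using zero1[of "1/2"] others insert.hyps by simp
    then have "\<omega> j * (\<beta> j * ?c - \<alpha> j * ?s) = 0"
      by (simp add: algebra_simps)
    then have 2: "\<beta> j * ?c - \<alpha> j * ?s = 0"
      using insert.prems(2)[of j] by simp
    have "\<alpha> j = 0 \<and> \<beta> j = 0"
      by (rule rotation_zero[OF 1 2]) (simp add: power2_eq_square[symmetric])
    then show ?thesis using True by simp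
  qed (use others insert.prems(4) in auto)
qed simp

section \<open>The free motion\<close>

text \<open>
  The free motion \<open>e\<^sup>s\<^sup>A\<close>. As \<open>A\<^sup>2 = - \<omega>\<^sub>i\<^sup>2\<close> on the \<open>i\<close>-th block, the exponential of that block is
  \<open>cos (\<omega>\<^sub>i s) + \<omega>\<^sub>i\<^sup>-\<^sup>1 sin (\<omega>\<^sub>i s) A\<close>.
\<close>

definition flow :: "('n \<Rightarrow> real) \<Rightarrow> real \<Rightarrow> 'n::finite phase \<Rightarrow> 'n phase" where
  "flow \<omega> s z = (\<chi> i. cos (\<omega> i * s) *\<^sub>R (z $ i) + (sin (\<omega> i * s) / \<omega> i) *\<^sub>R (drift \<omega> z $ i))"

text \<open>The transposed free motion, acting on dual vectors.\<close>

definition coflow :: "('n \<Rightarrow> real) \<Rightarrow> real \<Rightarrow> 'n::finite phase \<Rightarrow> 'n phase" where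
  "coflow \<omega> s p = (\<chi> i. cos (\<omega> i * s) *\<^sub>R (p $ i) +
     (sin (\<omega> i * s) / \<omega> i) *\<^sub>R (- (\<omega> i)\<^sup>2 * snd (p $ i), fst (p $ i)))"

lemma inner_flow: "flow \<omega> s z \<bullet> p = z \<bullet> coflow \<omega> s p"
  unfolding inner_vec_def
  by (intro sum.cong refl) (simp add: flow_def coflow_def drift_def inner_prod_def algebra_simps)

lemma bounded_linear_drift: "bounded_linear (drift \<omega>)"
  unfolding linear_conv_bounded_linear[symmetric]
  by (rule linearI) (auto simp: drift_def vec_eq_iff algebra_simps)

lemma drift_drift: "drift \<omega> (drift \<omega> z) $ i = - (\<omega> i)\<^sup>2 *\<^sub>R (z $ i)"
  by (simp add: drift_def prod_eq_iff)

lemma flow_diff: "flow \<omega> s (z - w) = flow \<omega> s z - flow \<omega> s w"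
  by (simp add: flow_def vec_eq_iff algebra_simps bounded_linear.linear[OF bounded_linear_drift] linear_diff)

lemma amplitude_coflow:
  assumes "\<omega> i > 0" shows "amplitude \<omega> (coflow \<omega> s p) i = amplitude \<omega> p i"
proof -
  define c d where "c = cos (\<omega> i * s)" and "d = sin (\<omega> i * s)"
  define a b where "a = fst (p $ i) / \<omega> i" and "b = snd (p $ i)"
  have "(snd (coflow \<omega> s p $ i))\<^sup>2 + (fst (coflow \<omega> s p $ i))\<^sup>2 / (\<omega> i)\<^sup>2
      = (snd (coflow \<omega> s p $ i))\<^sup>2 + (fst (coflow \<omega> s p $ i) / \<omega> i)\<^sup>2"
    by (simp add: power_divide)
  also have "\<dots> = (c * b + d * a)\<^sup>2 + (c * a - d * b)\<^sup>2"
    using assms by (simp add: coflow_def c_def d_def a_def b_def field_simps power2_eq_square)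
  also have "\<dots> = (c\<^sup>2 + d\<^sup>2) * (b\<^sup>2 + a\<^sup>2)"
    by (simp add: algebra_simps power2_eq_square)
  also have "c\<^sup>2 + d\<^sup>2 = 1" by (simp add: c_def d_def)
  finally show ?thesis by (simp add: amplitude_def a_def b_def power_divide)
qed

lemma Hnorm_coflow:
  assumes "\<And>i. \<omega> i > 0" shows "Hnorm \<omega> (coflow \<omega> s p) = Hnorm \<omega> p"
  using assms by (simp add: Hnorm_def amplitude_coflow)

lemma flow_minus_flow:
  assumes "\<And>i. \<omega> i > 0" shows "flow \<omega> (- s) (flow \<omega> s z) = z"
proof -
  have "flow \<omega> (- s) (flow \<omega> s z) $ i = z $ i" for i
  proof -
    define c d where "c = cos (\<omega> i * s)" and "d = sin (\<omega> i * s)"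
    have cd: "cos (\<omega> i * s) = c" "cos (s * \<omega> i) = c" "sin (\<omega> i * s) = d" "sin (s * \<omega> i) = d"
      by (simp_all add: c_def d_def mult.commute)
    have "flow \<omega> (- s) (flow \<omega> s z) $ i = (c\<^sup>2 + d\<^sup>2) *\<^sub>R (z $ i)"
      using assms[of i]
      by (simp add: flow_def drift_def prod_eq_iff power2_eq_square field_simps cd)
    then show ?thesis by (simp add: c_def d_def)
  qed
  then show ?thesis by (simp add: vec_eq_iff)
qed

lemma flow_zero [simp]: "flow \<omega> s 0 = 0"
  using flow_diff[of \<omega> s 0 0] by simp

lemma norm_vec_le_sum: "norm (v :: 'a::real_normed_vector ^ 'n) \<le> (\<Sum>i\<in>UNIV. norm (v $ i))"
  unfolding norm_vec_def by (rule L2_set_le_sum) simp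

lemma abs_cos_diff_le: "\<bar>cos x - cos y\<bar> \<le> \<bar>x - y\<bar>" for x y :: real
proof -
  have "\<bar>cos x - cos y\<bar> = 2 * (\<bar>sin ((x + y) / 2)\<bar> * \<bar>sin ((y - x) / 2)\<bar>)"
    by (simp add: cos_diff_cos abs_mult)
  also have "\<dots> \<le> 2 * (1 * \<bar>(y - x) / 2\<bar>)"
    by (intro mult_left_mono mult_mono abs_sin_x_le_abs_x) auto
  finally show ?thesis by simp
qed

lemma abs_sin_diff_le: "\<bar>sin x - sin y\<bar> \<le> \<bar>x - y\<bar>" for x y :: real
  using abs_cos_diff_le[of "x - pi/2" "y - pi/2"] by (simp add: cos_diff)

lemma flow_lipschitz:
  fixes \<omega> :: "'n::finite \<Rightarrow> real"
  assumes \<omega>: "\<And>i. \<omega> i > 0"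
  obtains L where "L > 0" "\<And>s z. norm (flow \<omega> s z) \<le> L * norm z"
    "\<And>s t z. norm (flow \<omega> s z - flow \<omega> t z) \<le> L * \<bar>s - t\<bar> * norm z"
proof -
  obtain D where D: "D > 0" "\<And>z. norm (drift \<omega> z) \<le> norm z * D"
    using bounded_linear.pos_bounded[OF bounded_linear_drift, of \<omega>] by blast
  have zi: "norm (z $ i) \<le> norm z" "norm (drift \<omega> z $ i) \<le> D * norm z" for z i
    using Finite_Cartesian_Product.norm_nth_le[of z i] Finite_Cartesian_Product.norm_nth_le[of "drift \<omega> z" i] D(2)[of z] by (auto simp: mult.commute)
  define L where "L = (\<Sum>i\<in>UNIV. (1 + D / \<omega> i) + (\<omega> i + D))"
  have "norm (flow \<omega> s z) \<le> L * norm z" for s z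
  proof -
    have "norm (flow \<omega> s z $ i) \<le> ((1 + D / \<omega> i) + (\<omega> i + D)) * norm z" for i
    proof -
      have "norm (flow \<omega> s z $ i) \<le> \<bar>cos (\<omega> i * s)\<bar> * norm (z $ i) + (\<bar>sin (\<omega> i * s)\<bar> / \<omega> i) * norm (drift \<omega> z $ i)"
        using \<omega>[of i] by (simp add: flow_def norm_triangle_le)
      also have "\<dots> \<le> 1 * norm z + (1 / \<omega> i) * (D * norm z)"
        using \<omega>[of i] zi[of z i] by (intro add_mono mult_mono) (auto simp: divide_right_mono)
      also have "\<dots> \<le> 1 * norm z + (1 / \<omega> i) * (D * norm z) + (\<omega> i + D) * norm z"
        using \<omega>[of i] D(1) by simp
      finally show ?thesis by (simp add: algebra_simps)
    qed
    then have "(\<Sum>i\<in>UNIV. norm (flow \<omega> s z $ i)) \<le> L * norm z"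
      unfolding L_def sum_distrib_right by (intro sum_mono)
    then show ?thesis using norm_vec_le_sum order.trans by blast
  qed
  moreover have "norm (flow \<omega> s z - flow \<omega> t z) \<le> L * \<bar>s - t\<bar> * norm z" for s t z
  proof -
    have "norm ((flow \<omega> s z - flow \<omega> t z) $ i) \<le> ((1 + D / \<omega> i) + (\<omega> i + D)) * (\<bar>s - t\<bar> * norm z)" for i
    proof -
      have trig: "\<bar>cos (\<omega> i * s) - cos (\<omega> i * t)\<bar> \<le> \<omega> i * \<bar>s - t\<bar>"
        "\<bar>sin (\<omega> i * s) - sin (\<omega> i * t)\<bar> \<le> \<omega> i * \<bar>s - t\<bar>"
      proof -
        have e: "\<omega> i * \<bar>s - t\<bar> = \<bar>\<omega> i * s - \<omega> i * t\<bar>"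
          using \<omega>[of i] by (simp add: abs_mult flip: right_diff_distrib)
        show "\<bar>cos (\<omega> i * s) - cos (\<omega> i * t)\<bar> \<le> \<omega> i * \<bar>s - t\<bar>"
          unfolding e by (rule abs_cos_diff_le)
        show "\<bar>sin (\<omega> i * s) - sin (\<omega> i * t)\<bar> \<le> \<omega> i * \<bar>s - t\<bar>"
          unfolding e by (rule abs_sin_diff_le)
      qed
      have "(flow \<omega> s z - flow \<omega> t z) $ i = (cos (\<omega> i * s) - cos (\<omega> i * t)) *\<^sub>R (z $ i)
          + ((sin (\<omega> i * s) - sin (\<omega> i * t)) / \<omega> i) *\<^sub>R (drift \<omega> z $ i)"
        by (simp add: flow_def algebra_simps diff_divide_distrib)
      then have "norm ((flow \<omega> s z - flow \<omega> t z) $ i)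
          \<le> \<bar>cos (\<omega> i * s) - cos (\<omega> i * t)\<bar> * norm (z $ i)
          + (\<bar>sin (\<omega> i * s) - sin (\<omega> i * t)\<bar> / \<omega> i) * norm (drift \<omega> z $ i)"
        using \<omega>[of i] norm_triangle_ineq by (metis (no_types, lifting) abs_divide abs_of_pos norm_scaleR)
      also have "\<dots> \<le> (\<omega> i * \<bar>s - t\<bar>) * norm z + \<bar>s - t\<bar> * (D * norm z)"
        using \<omega>[of i] zi[of z i] trig by (intro add_mono mult_mono) (auto simp: field_simps)
      also have "\<dots> \<le> (\<omega> i * \<bar>s - t\<bar>) * norm z + \<bar>s - t\<bar> * (D * norm z) + (1 + D / \<omega> i) * (\<bar>s - t\<bar> * norm z)"
        using \<omega>[of i] D(1) by simp
      finally show ?thesis by (simp add: algebra_simps)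
    qed
    then have "(\<Sum>i\<in>UNIV. norm ((flow \<omega> s z - flow \<omega> t z) $ i)) \<le> L * (\<bar>s - t\<bar> * norm z)"
      unfolding L_def sum_distrib_right by (intro sum_mono)
    then show ?thesis
      using norm_vec_le_sum[of "flow \<omega> s z - flow \<omega> t z"] by (simp add: mult.assoc)
  qed
  moreover have "L > 0"
    unfolding L_def using \<omega> D(1) by (intro sum_pos) (auto intro!: add_pos_pos)
  ultimately show thesis using that by blast
qed

lemma has_vector_derivative_vec_lambda:
  fixes f :: "'n::finite \<Rightarrow> real \<Rightarrow> 'a::euclidean_space"
  assumes "\<And>i. (f i has_vector_derivative f' i) F"
  shows "((\<lambda>t. \<chi> i. f i t) has_vector_derivative (\<chi> i. f' i)) F"
proof -
  have eq: "(\<chi> i. v i) = (\<Sum>i\<in>UNIV. axis i (v i))" for v :: "'n \<Rightarrow> 'a"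
    by (simp add: vec_eq_iff axis_def)
  have bl: "bounded_linear (axis i :: 'a \<Rightarrow> 'a ^ 'n)" for i
    unfolding linear_conv_bounded_linear[symmetric]
    by (rule linearI) (auto simp: axis_def vec_eq_iff)
  show ?thesis
    unfolding eq by (intro has_vector_derivative_sum bounded_linear.has_vector_derivative[OF bl] assms)
qed

text \<open>Variation of constants.\<close>

lemma has_vector_derivative_pullback:
  fixes \<omega> :: "'n::finite \<Rightarrow> real"
  assumes \<omega>: "\<And>i. \<omega> i > 0"
    and x: "(x has_vector_derivative (drift \<omega> (x t) + v)) (at t within S)"
  shows "((\<lambda>t. flow \<omega> (a - t) (x t)) has_vector_derivative flow \<omega> (a - t) v) (at t within S)"
proof -
  have xi: "((\<lambda>t. x t $ i) has_vector_derivative (drift \<omega> (x t) + v) $ i) (at t within S)" for i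
    by (rule bounded_linear.has_vector_derivative[OF bounded_linear_vec_nth x])
  have dxi: "((\<lambda>t. drift \<omega> (x t) $ i) has_vector_derivative drift \<omega> (drift \<omega> (x t) + v) $ i) (at t within S)" for i
    by (rule bounded_linear.has_vector_derivative[OF bounded_linear_vec_nth
          bounded_linear.has_vector_derivative[OF bounded_linear_drift x]])
  show ?thesis
    unfolding flow_def
  proof (rule has_vector_derivative_vec_lambda)
    fix i
    have nz: "\<omega> i \<noteq> 0" using \<omega>[of i] by simp
    have c: "((\<lambda>t. cos (\<omega> i * (a - t))) has_real_derivative \<omega> i * sin (\<omega> i * (a - t))) (at t within S)"
      by (auto intro!: derivative_eq_intros)
    have s: "((\<lambda>t. sin (\<omega> i * (a - t)) / \<omega> i) has_real_derivative - cos (\<omega> i * (a - t))) (at t within S)"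
      using nz by (auto intro!: derivative_eq_intros simp: field_simps)
    let ?c = "cos (\<omega> i * (a - t))" and ?s = "sin (\<omega> i * (a - t))"
    have "((\<lambda>t. cos (\<omega> i * (a - t)) *\<^sub>R x t $ i + (sin (\<omega> i * (a - t)) / \<omega> i) *\<^sub>R drift \<omega> (x t) $ i)
      has_vector_derivative
        (?c *\<^sub>R ((drift \<omega> (x t) + v) $ i) + (\<omega> i * ?s) *\<^sub>R (x t $ i)) +
        ((?s / \<omega> i) *\<^sub>R (drift \<omega> (drift \<omega> (x t) + v) $ i) + (- ?c) *\<^sub>R (drift \<omega> (x t) $ i))) (at t within S)"
      by (intro has_vector_derivative_add has_vector_derivative_scaleR c s xi dxi)
    also have "(?c *\<^sub>R ((drift \<omega> (x t) + v) $ i) + (\<omega> i * ?s) *\<^sub>R (x t $ i)) +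
        ((?s / \<omega> i) *\<^sub>R (drift \<omega> (drift \<omega> (x t) + v) $ i) + (- ?c) *\<^sub>R (drift \<omega> (x t) $ i))
      = ?c *\<^sub>R (v $ i) + (?s / \<omega> i) *\<^sub>R (drift \<omega> v $ i)"
    proof -
      have *: "drift \<omega> (drift \<omega> (x t) + v) $ i = - (\<omega> i)\<^sup>2 *\<^sub>R (x t $ i) + drift \<omega> v $ i"
        by (simp add: bounded_linear.linear[OF bounded_linear_drift] linear_add drift_drift)
      then show ?thesis unfolding * using nz by (simp add: algebra_simps power2_eq_square)
    qed
    finally show "((\<lambda>t. cos (\<omega> i * (a - t)) *\<^sub>R x t $ i + (sin (\<omega> i * (a - t)) / \<omega> i) *\<^sub>R drift \<omega> (x t) $ i)
      has_vector_derivative ?c *\<^sub>R (v $ i) + (?s / \<omega> i) *\<^sub>R (drift \<omega> v $ i)) (at t within S)" .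
  qed
qed

section \<open>Motions under the basic control\<close>

text \<open>
  The frequencies need not be distinct here; distinctness only matters for observability.
\<close>

locale oscillators =
  fixes \<omega> :: "'n::finite \<Rightarrow> real"
  assumes frequency_pos: "\<omega> i > 0"

sublocale oscillators \<subseteq> strictly_convex_norm "Hnorm \<omega>"
  by (rule strictly_convex_norm_Hnorm) (rule frequency_pos)

context oscillators
begin

lemma rho_eq_dual: "rho \<omega> = dual"
  by (simp add: fun_eq_iff rho_def dual_def)

lemma dual_flow: "dual (flow \<omega> s z) = dual z"
proof -
  have le: "dual (flow \<omega> s z) \<le> dual z" for s z
    using support_le[of "flow \<omega> s z"] inner_support[of "flow \<omega> s z"] dual_upper[of "coflow \<omega> s (support (flow \<omega> s z))" z]
    by (simp add: Hnorm_coflow[of \<omega>, OF frequency_pos] inner_flow)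
  show ?thesis
    using le[of s z] le[of "- s" "flow \<omega> s z"] by (simp add: flow_minus_flow[of \<omega>, OF frequency_pos])
qed

lemma flow_eq_zero_iff [simp]: "flow \<omega> s z = 0 \<longleftrightarrow> z = 0"
  using flow_minus_flow[of \<omega>, OF frequency_pos, of s z] by auto

lemma support_flow:
  assumes "z \<noteq> 0" shows "support (flow \<omega> s z) = coflow \<omega> (- s) (support z)"
proof (rule support_unique[symmetric])
  show "flow \<omega> s z \<bullet> coflow \<omega> (- s) (support z) = dual (flow \<omega> s z)"
    by (simp add: inner_flow[symmetric] flow_minus_flow[of \<omega>, OF frequency_pos] inner_support dual_flow)
qed (use assms support_le in \<open>simp_all add: Hnorm_coflow[of \<omega>, OF frequency_pos]\<close>)

lemma continuous_on_flow_input: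
  fixes f :: "real \<Rightarrow> real"
  assumes "continuous_on S f" shows "continuous_on S (\<lambda>s. flow \<omega> (f s) z)"
proof -
  have "\<omega> i \<noteq> 0" for i using frequency_pos[of i] by simp
  then show ?thesis
    unfolding flow_def by (auto intro!: continuous_intros assms)
qed

text \<open>
  The mean of \<open>\<bar>\<langle>B, e\<^sup>-\<^sup>s\<^sup>A\<^sup>* p\<rangle>\<bar>\<close> over one unit of time, which is the output of the adjoint free
  motion that starts at \<open>p\<close>.
\<close>

definition observation :: "'n phase \<Rightarrow> real" where
  "observation p = integral {0..1} (\<lambda>s. \<bar>flow \<omega> (- s) Bvec \<bullet> p\<bar>)"

lemma observation_integrable: "(\<lambda>s. \<bar>flow \<omega> (- s) Bvec \<bullet> p\<bar>) integrable_on {a..b}"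
  by (intro integrable_continuous_interval continuous_intros continuous_on_flow_input)

lemma inner_flow_Bvec:
  "flow \<omega> (- s) Bvec \<bullet> p
   = (\<Sum>i\<in>UNIV. snd (p $ i) * cos (\<omega> i * s) + (- fst (p $ i) / \<omega> i) * sin (\<omega> i * s))"
  unfolding inner_vec_def
  by (intro sum.cong refl) (simp add: flow_def Bvec_def drift_def inner_prod_def)

text \<open>Positivity is the observability of the system.\<close>

lemma norm_functional_observation:
  assumes "inj \<omega>" shows "norm_functional observation"
proof
  fix p q :: "'n phase"
  have "observation (p + q) \<le> integral {0..1} (\<lambda>s. \<bar>flow \<omega> (- s) Bvec \<bullet> p\<bar> + \<bar>flow \<omega> (- s) Bvec \<bullet> q\<bar>)"
    unfolding observation_def
    by (intro integral_le integrable_add observation_integrable) (simp add: inner_add_right)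
  also have "\<dots> = observation p + observation q"
    unfolding observation_def by (intro integral_add observation_integrable)
  finally show "observation (p + q) \<le> observation p + observation q" .
  show "observation (c *\<^sub>R p) = \<bar>c\<bar> * observation p" for c
    by (simp add: observation_def abs_mult)
  show "observation p > 0" if "p \<noteq> 0"
  proof (rule ccontr)
    assume "\<not> observation p > 0"
    moreover have "observation p \<ge> 0"
      unfolding observation_def by (intro integral_nonneg observation_integrable) simp
    ultimately have "observation p = 0" by simp
    moreover have "continuous_on {0..1} (\<lambda>s. \<bar>flow \<omega> (- s) Bvec \<bullet> p\<bar>)"
      by (intro continuous_intros continuous_on_flow_input)
    ultimately have "\<forall>s\<in>{0..1}. \<bar>flow \<omega> (- s) Bvec \<bullet> p\<bar> = 0"
      using integral_eq_0_iff[of 0 1 "\<lambda>s. \<bar>flow \<omega> (- s) Bvec \<bullet> p\<bar>"]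
      unfolding observation_def by simp
    then have zero: "flow \<omega> (- s) Bvec \<bullet> p = 0" if "s \<in> {0<..<1}" for s
      using that by simp
    have "snd (p $ i) = 0 \<and> - fst (p $ i) / \<omega> i = 0" for i
      by (rule trig_sum_coefficients_zero[of UNIV \<omega> "\<lambda>i. snd (p $ i)" "\<lambda>i. - fst (p $ i) / \<omega> i"])
        (use assms frequency_pos zero in \<open>simp_all add: inner_flow_Bvec\<close>)
    moreover have "\<omega> i \<noteq> 0" for i using frequency_pos[of i] by simp
    ultimately have "p = 0" by (simp add: vec_eq_iff prod_eq_iff)
    with that show False by simp
  qed
qed

lemma basic_control_dissipates:
  assumes "u \<in> basic_control \<omega> z" "z \<noteq> 0"
  shows "\<bar>u\<bar> \<le> 1" "u * (Bvec \<bullet> support z) = - \<bar>Bvec \<bullet> support z\<bar>"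
proof -
  have g: "gradient (rho \<omega>) z = support z"
    using gradient_dual[OF assms(2)] by (simp add: rho_eq_dual)
  obtain v where "u = - v" "v \<in> multisign (Bvec \<bullet> support z)"
    using assms(1) by (auto simp: basic_control_def g)
  then show "\<bar>u\<bar> \<le> 1" "u * (Bvec \<bullet> support z) = - \<bar>Bvec \<bullet> support z\<bar>"
    by (auto simp: multisign_def sgn_if split: if_splits)
qed

lemma abs_continuous_pullback:
  fixes x :: "real \<Rightarrow> 'n phase"
  assumes ac: "abs_continuous_on_interval a b x"
  shows "abs_continuous_on_interval a b (\<lambda>t. flow \<omega> (c - t) (x t))"
proof -
  obtain L where L: "L > 0" "\<And>s z. norm (flow \<omega> s z) \<le> L * norm z"
    "\<And>s t z. norm (flow \<omega> s z - flow \<omega> t z) \<le> L * \<bar>s - t\<bar> * norm z"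
    by (rule flow_lipschitz[of \<omega>, OF frequency_pos]) blast
  have "compact (x ` {a..b})"
    by (intro compact_continuous_image abs_continuous_on_interval_imp_continuous_on[OF ac] compact_Icc)
  then obtain R where R: "R > 0" "\<And>t. t \<in> {a..b} \<Longrightarrow> norm (x t) \<le> R"
    using compact_imp_bounded[of "x ` {a..b}"] by (auto simp: bounded_pos)
  show ?thesis
  proof (rule abs_continuous_on_interval_comparison[OF ac])
    fix u v assume uv: "a \<le> u" "u \<le> v" "v \<le> b"
    have "flow \<omega> (c - v) (x v) - flow \<omega> (c - u) (x u)
        = flow \<omega> (c - v) (x v - x u) + (flow \<omega> (c - v) (x u) - flow \<omega> (c - u) (x u))"
      by (simp add: flow_diff)
    also have "norm \<dots> \<le> L * norm (x v - x u) + L * \<bar>(c - v) - (c - u)\<bar> * norm (x u)"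
      by (intro norm_triangle_mono L)
    also have "L * \<bar>(c - v) - (c - u)\<bar> * norm (x u) \<le> L * (v - u) * R"
      using L(1) R(2)[of u] uv by (intro mult_mono) auto
    finally show "norm (flow \<omega> (c - v) (x v) - flow \<omega> (c - u) (x u))
        \<le> L * norm (x v - x u) + (L * R) * (v - u)"
      by (simp add: mult_ac)
  qed (use L(1) R(1) in auto)
qed

text \<open>
  Pulling the motion back along the free flow leaves only the control term. Outside a null set a
  value of the control is selected; on the null set it is set to \<open>0\<close>, so that the bound holds
  everywhere.
\<close>

lemma pullback_derivative:
  fixes x :: "real \<Rightarrow> 'n phase"
  assumes motion: "basic_motion \<omega> a b x" and nz: "\<And>t. t \<in> {a..b} \<Longrightarrow> x t \<noteq> 0"
  defines "y \<equiv> \<lambda>t. flow \<omega> (a - t) (x t)"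
  shows "\<exists>u. (\<forall>t. \<bar>u t\<bar> \<le> 1) \<and> (AE t in lborel. t \<in> {a..b} \<longrightarrow>
      (y has_vector_derivative u t *\<^sub>R flow \<omega> (a - t) Bvec) (at t within {a..b}) \<and>
      u t * (flow \<omega> (a - t) Bvec \<bullet> support (y t)) = - \<bar>flow \<omega> (a - t) Bvec \<bullet> support (y t)\<bar>)"
proof -
  define P where "P t v \<longleftrightarrow> \<bar>v\<bar> \<le> 1 \<and>
      (y has_vector_derivative v *\<^sub>R flow \<omega> (a - t) Bvec) (at t within {a..b}) \<and>
      v * (flow \<omega> (a - t) Bvec \<bullet> support (y t)) = - \<bar>flow \<omega> (a - t) Bvec \<bullet> support (y t)\<bar>" for t v
  define u where "u t = (if \<exists>v. P t v then SOME v. P t v else 0)" for t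
  have u: "P t (u t)" if "\<exists>v. P t v" for t
    using that someI_ex[OF that] by (simp add: u_def)
  have "\<bar>u t\<bar> \<le> 1" for t
    using u[of t] by (cases "\<exists>v. P t v") (auto simp: P_def u_def)
  moreover have "AE t in lborel. t \<in> {a..b} \<longrightarrow>
        (\<exists>u \<in> basic_control \<omega> (x t).
           (x has_vector_derivative (drift \<omega> (x t) + u *\<^sub>R Bvec)) (at t within {a..b}))"
    using motion by (simp add: basic_motion_def)
  then have "AE t in lborel. t \<in> {a..b} \<longrightarrow> (\<exists>v. P t v)"
  proof (rule AE_mp, intro AE_I2 impI)
    fix t assume t: "t \<in> {a..b}" and "t \<in> {a..b} \<longrightarrow>
        (\<exists>u \<in> basic_control \<omega> (x t).
           (x has_vector_derivative (drift \<omega> (x t) + u *\<^sub>R Bvec)) (at t within {a..b}))"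
    then obtain v where v: "v \<in> basic_control \<omega> (x t)"
      and x': "(x has_vector_derivative (drift \<omega> (x t) + v *\<^sub>R Bvec)) (at t within {a..b})"
      by blast
    have xt: "x t = flow \<omega> (t - a) (y t)"
      using flow_minus_flow[of \<omega>, OF frequency_pos, of "a - t" "x t"] by (simp add: y_def)
    have "y t \<noteq> 0" using nz[OF t] by (simp add: y_def)
    then have "Bvec \<bullet> support (x t) = flow \<omega> (a - t) Bvec \<bullet> support (y t)"
      by (simp add: xt support_flow inner_flow)
    moreover have "flow \<omega> (a - t) (v *\<^sub>R Bvec) = v *\<^sub>R flow \<omega> (a - t) Bvec"
      by (simp add: flow_def drift_def vec_eq_iff prod_eq_iff algebra_simps)
    ultimately have "P t v"
      using has_vector_derivative_pullback[of \<omega>, OF frequency_pos x', of a] basic_control_dissipates[OF v nz[OF t]]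
      by (simp add: P_def y_def)
    then show "\<exists>v. P t v" by blast
  qed
  then have "AE t in lborel. t \<in> {a..b} \<longrightarrow>
      (y has_vector_derivative u t *\<^sub>R flow \<omega> (a - t) Bvec) (at t within {a..b}) \<and>
      u t * (flow \<omega> (a - t) Bvec \<bullet> support (y t)) = - \<bar>flow \<omega> (a - t) Bvec \<bullet> support (y t)\<bar>"
  proof (rule AE_mp, intro AE_I2 impI)
    fix t assume "t \<in> {a..b}" and "t \<in> {a..b} \<longrightarrow> (\<exists>v. P t v)"
    then have "P t (u t)" by (intro u) simp
    then show "(y has_vector_derivative u t *\<^sub>R flow \<omega> (a - t) Bvec) (at t within {a..b}) \<and>
      u t * (flow \<omega> (a - t) Bvec \<bullet> support (y t)) = - \<bar>flow \<omega> (a - t) Bvec \<bullet> support (y t)\<bar>"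
      by (simp add: P_def)
  qed
  ultimately show ?thesis by blast
qed

text \<open>
  Within one unit of time the pulled-back motion stays within a fixed distance of its start, so far
  from the origin its extremal vector is nearly constant, equal to \<open>p\<close> say. The loss of
  \<open>dual\<close> is then at least \<open>observation p\<close> up to a small error, and \<open>observation\<close> is bounded
  below on the unit sphere of \<open>Hnorm \<omega>\<close>.
\<close>

lemma unit_time_decrease:
  assumes "inj \<omega>"
  obtains C \<delta> where "C > 0" "\<delta> > 0"
    "\<And>x a. basic_motion \<omega> a (a + 1) x \<Longrightarrow> (\<And>t. t \<in> {a..a + 1} \<Longrightarrow> dual (x t) \<ge> C)
       \<Longrightarrow> dual (x (a + 1)) \<le> dual (x a) - \<delta>"
proof -
  interpret obs: norm_functional observation
    by (rule norm_functional_observation[OF assms])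
  obtain m where m: "m > 0" "\<And>p. m * norm p \<le> observation p"
    by (rule obs.lower_bound) blast
  obtain L where L: "L > 0" "\<And>p. Hnorm \<omega> p \<le> L * norm p"
    by (rule upper_bound) blast
  obtain F where F: "F > 0" "\<And>s z. norm (flow \<omega> s z) \<le> F * norm z"
    by (rule flow_lipschitz[of \<omega>, OF frequency_pos]) blast
  obtain R where R: "R > 0" "\<And>x y. \<bar>dual x - dual y\<bar> \<le> R * norm (x - y)"
    by (rule dual_lipschitz) blast
  define K where "K = F * norm (Bvec :: 'n phase) + 1"
  have K: "K > 0" "norm (flow \<omega> s Bvec) \<le> K" for s
    using F(1) F(2)[of s Bvec] by (auto simp: K_def intro: add_nonneg_pos)
  define \<delta> where "\<delta> = m / (2 * L)"
  have "\<delta> > 0" using m(1) L(1) by (simp add: \<delta>_def)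
  then have "\<delta> / K > 0" using K(1) by simp
  then obtain C where C: "C > 0"
    "\<And>x y. dual x \<ge> C \<Longrightarrow> y \<noteq> 0 \<Longrightarrow> norm (y - x) \<le> K \<Longrightarrow> norm (support y - support x) \<le> \<delta> / K"
    by (rule support_slowly_varying[where K = K]) blast
  show thesis
  proof
    fix x a assume motion: "basic_motion \<omega> a (a + 1) x"
      and far: "\<And>t. t \<in> {a..a + 1} \<Longrightarrow> dual (x t) \<ge> C"
    define y where "y t = flow \<omega> (a - t) (x t)" for t
    define p where "p = support (y a)"
    have nz: "x t \<noteq> 0" if "t \<in> {a..a + 1}" for t
      using far[OF that] C(1) by auto
    then have ynz: "y t \<noteq> 0" if "t \<in> {a..a + 1}" for t
      using that by (simp add: y_def)
    have "\<exists>u. (\<forall>t. \<bar>u t\<bar> \<le> 1) \<and> (AE t in lborel. t \<in> {a..a + 1} \<longrightarrow>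
      (y has_vector_derivative u t *\<^sub>R flow \<omega> (a - t) Bvec) (at t within {a..a + 1}) \<and>
      u t * (flow \<omega> (a - t) Bvec \<bullet> support (y t)) = - \<bar>flow \<omega> (a - t) Bvec \<bullet> support (y t)\<bar>)"
      by (rule pullback_derivative[OF motion, folded y_def]) (rule nz)
    then obtain u where u: "\<forall>t. \<bar>u t\<bar> \<le> 1" and ae: "AE t in lborel. t \<in> {a..a + 1} \<longrightarrow>
      (y has_vector_derivative u t *\<^sub>R flow \<omega> (a - t) Bvec) (at t within {a..a + 1}) \<and>
      u t * (flow \<omega> (a - t) Bvec \<bullet> support (y t)) = - \<bar>flow \<omega> (a - t) Bvec \<bullet> support (y t)\<bar>"
      by (elim exE conjE)
    have ac: "abs_continuous_on_interval a (a + 1) y"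
      using motion abs_continuous_pullback[of a "a + 1" x a]
      by (simp add: basic_motion_def y_def[abs_def])
    have near: "norm (y t - y a) \<le> K" if t: "t \<in> {a..a + 1}" for t
    proof -
      have "((\<lambda>r. u r *\<^sub>R flow \<omega> (a - r) Bvec) has_integral (y t - y a)) {a..t}"
      proof (rule fundamental_theorem_of_calculus_abs_continuous)
        show "a \<le> t" using t by simp
        show "abs_continuous_on_interval a t y"
          by (rule abs_continuous_on_interval_subset[OF ac]) (use t in auto)
        show "AE r in lborel. r \<in> {a..t} \<longrightarrow>
            (y has_vector_derivative u r *\<^sub>R flow \<omega> (a - r) Bvec) (at r within {a..t})"
          using ae
        proof (rule AE_mp, intro AE_I2 impI)
          fix r assume "r \<in> {a..t}" and "r \<in> {a..a + 1} \<longrightarrow>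
            (y has_vector_derivative u r *\<^sub>R flow \<omega> (a - r) Bvec) (at r within {a..a + 1}) \<and>
            u r * (flow \<omega> (a - r) Bvec \<bullet> support (y r)) = - \<bar>flow \<omega> (a - r) Bvec \<bullet> support (y r)\<bar>"
          then have "(y has_vector_derivative u r *\<^sub>R flow \<omega> (a - r) Bvec) (at r within {a..a + 1})"
            using t by auto
          then show "(y has_vector_derivative u r *\<^sub>R flow \<omega> (a - r) Bvec) (at r within {a..t})"
            by (rule has_vector_derivative_within_subset) (use t in auto)
        qed
      qed
      then have "norm (y t - y a) \<le> K * measure lborel (cbox a t)"
      proof (intro has_integral_bound[where f = "\<lambda>r. u r *\<^sub>R flow \<omega> (a - r) Bvec"])
        show "norm (u r *\<^sub>R flow \<omega> (a - r) Bvec) \<le> K" for r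
          using mult_mono[OF spec[OF u, of r] K(2)[of "a - r"]] by simp
      qed (use K(1) in auto)
      also have "\<dots> \<le> K * 1" using t K(1) by (intro mult_left_mono) auto
      finally show ?thesis by simp
    qed
    have "((\<lambda>t. - \<bar>flow \<omega> (a - t) Bvec \<bullet> support (y t)\<bar>) has_integral (dual (y (a + 1)) - dual (y a))) {a..a + 1}"
    proof (rule fundamental_theorem_of_calculus_abs_continuous)
      show "abs_continuous_on_interval a (a + 1) (\<lambda>t. dual (y t))"
        by (rule abs_continuous_on_interval_comparison[OF ac, of R 0]) (use R in auto)
      show "AE t in lborel. t \<in> {a..a + 1} \<longrightarrow> ((\<lambda>t. dual (y t)) has_vector_derivative
          - \<bar>flow \<omega> (a - t) Bvec \<bullet> support (y t)\<bar>) (at t within {a..a + 1})"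
        using ae
      proof (rule AE_mp, intro AE_I2 impI)
        fix t assume t: "t \<in> {a..a + 1}" and "t \<in> {a..a + 1} \<longrightarrow>
          (y has_vector_derivative u t *\<^sub>R flow \<omega> (a - t) Bvec) (at t within {a..a + 1}) \<and>
          u t * (flow \<omega> (a - t) Bvec \<bullet> support (y t)) = - \<bar>flow \<omega> (a - t) Bvec \<bullet> support (y t)\<bar>"
        then have y': "(y has_vector_derivative u t *\<^sub>R flow \<omega> (a - t) Bvec) (at t within {a..a + 1})"
          and diss: "u t * (flow \<omega> (a - t) Bvec \<bullet> support (y t)) = - \<bar>flow \<omega> (a - t) Bvec \<bullet> support (y t)\<bar>"
          by auto
        have "((\<lambda>t. dual (y t)) has_derivative (\<lambda>h. (h *\<^sub>R (u t *\<^sub>R flow \<omega> (a - t) Bvec)) \<bullet> support (y t)))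
            (at t within {a..a + 1})"
          using has_derivative_compose[OF y'[unfolded has_vector_derivative_def]
              GDERIV_dual[OF ynz[OF t], unfolded gderiv_def]] .
        then show "((\<lambda>t. dual (y t)) has_vector_derivative
          - \<bar>flow \<omega> (a - t) Bvec \<bullet> support (y t)\<bar>) (at t within {a..a + 1})"
          by (simp add: has_vector_derivative_def mult.assoc diss)
      qed
    qed simp
    moreover have "((\<lambda>t. - \<bar>flow \<omega> (a - t) Bvec \<bullet> p\<bar> + \<delta>) has_integral (- observation p + \<delta>)) {a..a + 1}"
    proof -
      have "((\<lambda>s. \<bar>flow \<omega> (- s) Bvec \<bullet> p\<bar>) has_integral observation p) {0..1}"
        unfolding observation_def by (intro integrable_integral observation_integrable)
      then have "((\<lambda>t. \<bar>flow \<omega> (a - t) Bvec \<bullet> p\<bar>) has_integral observation p) {a..a + 1}"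
        using has_integral_shift_real_ivl_iff[of "\<lambda>s. \<bar>flow \<omega> (- s) Bvec \<bullet> p\<bar>" "observation p" 0 1 "- a"]
        by (simp add: algebra_simps)
      then show ?thesis
        using has_integral_add[OF has_integral_neg has_integral_const_real[of \<delta> a "a + 1"]] by fastforce
    qed
    ultimately have "dual (y (a + 1)) - dual (y a) \<le> - observation p + \<delta>"
    proof (rule has_integral_le)
      fix t assume t: "t \<in> {a..a + 1}"
      have "norm (support (y t) - p) \<le> \<delta> / K"
        unfolding p_def using far[of a] near[OF t] ynz[OF t] by (intro C(2)) (auto simp: y_def dual_flow)
      then have "norm (flow \<omega> (a - t) Bvec) * norm (support (y t) - p) \<le> K * (\<delta> / K)"
        using K(1) by (intro mult_mono K(2)) auto
      then have "\<bar>flow \<omega> (a - t) Bvec \<bullet> (support (y t) - p)\<bar> \<le> \<delta>"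
        using K(1) Cauchy_Schwarz_ineq2[of "flow \<omega> (a - t) Bvec" "support (y t) - p"] by simp
      then show "- \<bar>flow \<omega> (a - t) Bvec \<bullet> support (y t)\<bar> \<le> - \<bar>flow \<omega> (a - t) Bvec \<bullet> p\<bar> + \<delta>"
        by (simp add: inner_diff_right)
    qed
    moreover have "observation p \<ge> 2 * \<delta>"
    proof -
      have "1 \<le> L * norm p"
        using L(2)[of p] H_support[OF ynz[of a]] by (simp add: p_def)
      then have "2 * \<delta> \<le> m * norm p"
        using L(1) m(1) by (simp add: \<delta>_def field_simps)
      then show ?thesis using m(2)[of p] by simp
    qed
    ultimately show "dual (x (a + 1)) \<le> dual (x a) - \<delta>"
      by (simp add: y_def dual_flow)
  qed (use C(1) \<open>\<delta> > 0\<close> in auto)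
qed

lemma decrease_over_integer_time:
  assumes step: "\<And>x a. basic_motion \<omega> a (a + 1) x \<Longrightarrow> (\<And>t. t \<in> {a..a + 1} \<Longrightarrow> dual (x t) \<ge> C)
       \<Longrightarrow> dual (x (a + 1)) \<le> dual (x a) - \<delta>"
    and motion: "basic_motion \<omega> a (a + real T) x"
    and far: "\<And>t. t \<in> {a..a + real T} \<Longrightarrow> dual (x t) \<ge> C"
  shows "dual (x (a + real T)) \<le> dual (x a) - real T * \<delta>"
proof -
  have "dual (x (a + real k)) \<le> dual (x a) - real k * \<delta>" if "k \<le> T" for k
    using that
  proof (induction k)
    case (Suc k)
    let ?b = "a + real k"
    have sub: "{?b..?b + 1} \<subseteq> {a..a + real T}" using Suc.prems by auto
    have "basic_motion \<omega> ?b (?b + 1) x"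
      unfolding basic_motion_def
    proof
      show "abs_continuous_on_interval ?b (?b + 1) x"
        using motion sub by (auto simp: basic_motion_def intro: abs_continuous_on_interval_subset)
      have "AE t in lborel. t \<in> {a..a + real T} \<longrightarrow> (\<exists>u \<in> basic_control \<omega> (x t).
           (x has_vector_derivative (drift \<omega> (x t) + u *\<^sub>R Bvec)) (at t within {a..a + real T}))"
        using motion by (simp add: basic_motion_def)
      then show "AE t in lborel. t \<in> {?b..?b + 1} \<longrightarrow> (\<exists>u \<in> basic_control \<omega> (x t).
           (x has_vector_derivative (drift \<omega> (x t) + u *\<^sub>R Bvec)) (at t within {?b..?b + 1}))"
      proof (rule AE_mp, intro AE_I2 impI)
        fix t assume t: "t \<in> {?b..?b + 1}" and "t \<in> {a..a + real T} \<longrightarrow> (\<exists>u \<in> basic_control \<omega> (x t).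
           (x has_vector_derivative (drift \<omega> (x t) + u *\<^sub>R Bvec)) (at t within {a..a + real T}))"
        then obtain u where "u \<in> basic_control \<omega> (x t)"
          and "(x has_vector_derivative (drift \<omega> (x t) + u *\<^sub>R Bvec)) (at t within {a..a + real T})"
          using subsetD[OF sub t] by blast
        then show "\<exists>u \<in> basic_control \<omega> (x t).
           (x has_vector_derivative (drift \<omega> (x t) + u *\<^sub>R Bvec)) (at t within {?b..?b + 1})"
          using has_vector_derivative_within_subset[OF _ sub] by blast
      qed
    qed
    then have "dual (x (?b + 1)) \<le> dual (x ?b) - \<delta>"
      by (rule step) (rule far, rule subsetD[OF sub])
    then show ?case using Suc by (simp add: algebra_simps)
  qed simp
  from this[of T] show ?thesis by simp
qed

end

theorem theorem6:
  fixes \<omega> :: "'n::finite \<Rightarrow> real"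
  assumes "\<And>i. \<omega> i > 0" and "inj \<omega>"
  shows "\<exists>C>0. \<exists>c>0. \<forall>(x :: real \<Rightarrow> 'n phase) (t0 :: real) (T :: nat) (M :: real) (M' :: real).
           basic_motion \<omega> t0 (t0 + real T) x \<and>
           rho \<omega> (x t0) = M \<and> rho \<omega> (x (t0 + real T)) = M' \<and>
           (\<forall>t\<in>{t0..t0 + real T}. rho \<omega> (x t) \<ge> C)
           \<longrightarrow> real T \<le> c * (M - M')"
proof -
  interpret oscillators \<omega> by standard (rule assms(1))
  obtain C \<delta> where "C > 0" "\<delta> > 0"
    and step: "\<And>x a. basic_motion \<omega> a (a + 1) x \<Longrightarrow> (\<And>t. t \<in> {a..a + 1} \<Longrightarrow> dual (x t) \<ge> C)
       \<Longrightarrow> dual (x (a + 1)) \<le> dual (x a) - \<delta>"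
    using unit_time_decrease[OF assms(2)] by blast
  show ?thesis
  proof (rule exI[of _ C], rule conjI[OF \<open>C > 0\<close>], rule exI[of _ "1 / \<delta>"], intro conjI allI impI)
    show "1 / \<delta> > 0" using \<open>\<delta> > 0\<close> by simp
    fix x :: "real \<Rightarrow> 'n phase" and t0 :: real and T :: nat and M M' :: real
    assume H: "basic_motion \<omega> t0 (t0 + real T) x \<and>
           rho \<omega> (x t0) = M \<and> rho \<omega> (x (t0 + real T)) = M' \<and>
           (\<forall>t\<in>{t0..t0 + real T}. rho \<omega> (x t) \<ge> C)"
    have "dual (x (t0 + real T)) \<le> dual (x t0) - real T * \<delta>"
      by (rule decrease_over_integer_time[OF step]) (use H in \<open>auto simp: rho_eq_dual\<close>)
    then show "real T \<le> (1 / \<delta>) * (M - M')"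
      using H \<open>\<delta> > 0\<close> by (simp add: rho_eq_dual field_simps)
  qed
qed

end
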